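(* Let $\mathscr F$ be an acceptable space of analytic functions $\mathbb U\to\Sigma$. For each $m\ge1$ and $z\in\mathbb U$ the operator $E_{2,m}:\mathscr F^{(m+1)}_z\to F[2,m]$, $$E_{2,m}(x_m,\dots,x_0)=\begin{pmatrix} mx_m & x_{m-1} \\ {} (m-1)x_{m-1} & x_{m-2} \\ {} \vdots & \vdots \\ {} 2x_2 & x_1 \\ {} x_1 & x_0 \end{pmatrix},$$ has complemented range, and the quotient of $F[2,m]$ by $E_{2,m}[\mathscr F^{(m+1)}_z]$ is isomorphic to $\mathscr F^{(m-1)}_z$.
   Context: $A^\infty$ is the Fréchet algebra (pointwise product) of analytic $f:\mathbb D\to\mathbb C$ whose Taylor coefficients $(c_j)$ at $0$ are rapidly decreasing, with topology given by the norms $\sup_j|c_j|(j+1)^\alpha$, $\alpha>0$. For $\mathbb U\subset\mathbb C$ open and conformally equivalent to $\mathbb D$, $A^\infty_{\mathbb U}=\{f\circ\psi:f\in A^\infty\}$ with the transported topology, $\psi:\mathbb U\to\mathbb D$ any conformal equivalence. An acceptable space on $\mathbb U$ with values in a complex Banach space $\Sigma$ is a Banach space $\mathscr F$ of analytic functions $f:\mathbb U\to\Sigma$ such that: (a) evaluations $\delta_z:\mathscr F\to\Sigma$ are continuous; (b) $\mathscr F$ is a module over $A^\infty_{\mathbb U}$ under pointwise multiplication, with jointly continuous product; (c) for each conformal $\varphi:\mathbb U\to\mathbb D$ there is $K[\varphi]$ such that for analytic $f:\mathbb U\to\Sigma$, $\varphi f\in\mathscr F$ iff $f\in\mathscr F$,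 and then $K[\varphi]^{-1}\|\varphi f\|\le\|f\|\le K[\varphi]\|\varphi f\|$. Notation: $\tau_{(n,0]}f=\left(\frac{f^{(n-1)}}{(n-1)!},\dots,f',f\right)$. Rochberg spaces of an acceptable space: $\mathscr F^{(n)}_z=\{\tau_{(n,0]}f(z):f\in\mathscr F\}$ with the quotient norm; $\mathscr F^{(0)}_z=0$. The spaces $\mathscr T$ and $F[2,m]$: an acceptable space $\mathscr T$ of functions $\mathbb U\to\Sigma^2$ is constructed as follows. Fix a conformal map $\psi:\mathbb D\to\mathbb U$ and put $\mathscr G=\{f\circ\psi:f\in\mathscr F\}$ with $\|f\circ\psi\|_{\mathscr G}=\|f\|_{\mathscr F}$. Let $\mathscr G^{(2)}$ be the space of pairs $(g_1,g)$ of analytic functions $\mathbb D\to\Sigma$ with $g\in\mathscr G$ and $g_1-g'\in\mathscr G$, with norm $\|g_1-g'\|_{\mathscr G}+\|g\|_{\mathscr G}$. For $u=\psi(w)\in\mathbb U$ let $L(u)$ be the invertible upper triangular complex $2\times2$ matrix with $\tau_{(2,0]}(f\circ\psi)(w)=L(u)\,\tau_{(2,0]}f(u)$ for all $f$ analytic near $u$, i.e. $L(u)(x_1,x_0)=(\psi'(w)x_1,x_0)$. Then $\mathscr T=\{u\mapsto L(u)^{-1}G(\psi^{-1}(u)):G\in\mathscr G^{(2)}\}$ with the norm of $G$. It is acceptable; $\tau_{(2,0]}f\in\mathscr T$ with $\|\tau_{(2,0]}f\|_{\mathscr T}=\|f\|_{\mathscr F}$ for $f\in\mathscr F$; and $\mathscr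 T_u=\mathscr F^{(2)}_u$ with equivalent norms for all $u\in\mathbb U$. For fixed $z$, $F[2,m]=\mathscr T^{(m)}_z$ is the $m$-th Rochberg space of $\mathscr T$ at $z$; its elements are written as matrices with $m$ rows and $2$ columns with entries in $\Sigma$, whose rows, from top to bottom, are $\frac{F^{(m-1)}(z)}{(m-1)!},\dots,F'(z),F(z)$ for $F=(f_1,f_0)\in\mathscr T$. The operator $E_{2,m}$ sends $\tau_{(m+1,0]}f(z)$ to $\tau_{(m,0]}(f',f)(z)$, $f\in\mathscr F$. *)

theory Defs
  imports "HOL-Complex_Analysis.Complex_Analysis"
begin

class complex_banach = banach +
  fixes scaleC :: "complex \<Rightarrow> 'a \<Rightarrow> 'a" (infixr "*\<^sub>C" 75)
  assumes scaleC_add_right: "c *\<^sub>C (x + y) = c *\<^sub>C x + c *\<^sub>C y"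
    and scaleC_add_left: "(c + d) *\<^sub>C x = c *\<^sub>C x + d *\<^sub>C x"
    and scaleC_scaleC: "c *\<^sub>C d *\<^sub>C x = (c * d) *\<^sub>C x"
    and scaleC_one: "1 *\<^sub>C x = x"
    and norm_scaleC: "norm (c *\<^sub>C x) = cmod c * norm x"
    and scaleR_scaleC: "r *\<^sub>R x = complex_of_real r *\<^sub>C x"

instantiation prod :: (complex_banach, complex_banach) complex_banach
begin

definition scaleC_prod_def: "c *\<^sub>C p = (c *\<^sub>C fst p, c *\<^sub>C snd p)"

instance
proof
  fix c d :: complex and p q :: "'a \<times> 'b" and r :: real
  show "c *\<^sub>C (p + q) = c *\<^sub>C p + c *\<^sub>C q"
    by (simp add: scaleC_prod_def scaleC_add_right prod_eq_iff)
  show "(c + d) *\<^sub>C p = c *\<^sub>C p + d *\<^sub>C p"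
    by (simp add: scaleC_prod_def scaleC_add_left prod_eq_iff)
  show "c *\<^sub>C d *\<^sub>C p = (c * d) *\<^sub>C p"
    by (simp add: scaleC_prod_def scaleC_scaleC prod_eq_iff)
  show "1 *\<^sub>C p = p"
    by (simp add: scaleC_prod_def scaleC_one prod_eq_iff)
  show "norm (c *\<^sub>C p) = cmod c * norm p"
  proof -
    have "norm (c *\<^sub>C p) = sqrt ((cmod c)\<^sup>2 * ((norm (fst p))\<^sup>2 + (norm (snd p))\<^sup>2))"
      by (simp add: scaleC_prod_def norm_prod_def norm_scaleC power_mult_distrib distrib_left)
    then show ?thesis
      by (simp add: real_sqrt_mult norm_prod_def)
  qed
  show "r *\<^sub>R p = complex_of_real r *\<^sub>C p"
    by (simp add: scaleC_prod_def scaleR_scaleC prod_eq_iff)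
qed

end

definition has_cderiv :: "(complex \<Rightarrow> 'a::complex_banach) \<Rightarrow> 'a \<Rightarrow> complex \<Rightarrow> bool" where
  "has_cderiv f D z \<longleftrightarrow> (f has_derivative (\<lambda>h. h *\<^sub>C D)) (at z)"

definition cderiv :: "(complex \<Rightarrow> 'a::complex_banach) \<Rightarrow> complex \<Rightarrow> 'a" where
  "cderiv f z = (SOME D. has_cderiv f D z)"

text \<open>A function on an open set \<open>U\<close> is encoded as a total function vanishing outside \<open>U\<close>, so
  that equality of functions on \<open>U\<close> is equality in HOL.\<close>

definition analytic_fun :: "complex set \<Rightarrow> (complex \<Rightarrow> 'a::complex_banach) \<Rightarrow> bool" where
  "analytic_fun U f \<longleftrightarrow> (\<forall>z\<in>U. \<exists>D. has_cderiv f D z) \<and> (\<forall>z. z \<notin> U \<longrightarrow> f z = 0)"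

definition pull :: "complex set \<Rightarrow> (complex \<Rightarrow> complex) \<Rightarrow> (complex \<Rightarrow> 'a::zero) \<Rightarrow> complex \<Rightarrow> 'a" where
  "pull V h f = (\<lambda>w. if w \<in> V then f (h w) else 0)"

abbreviation unit_disc :: "complex set" where
  "unit_disc \<equiv> ball 0 1"

text \<open>The inverse of a holomorphic bijection between open sets is automatically holomorphic.\<close>

definition conformal_equiv :: "(complex \<Rightarrow> complex) \<Rightarrow> complex set \<Rightarrow> complex set \<Rightarrow> bool" where
  "conformal_equiv \<phi> U V \<longleftrightarrow> \<phi> holomorphic_on U \<and> bij_betw \<phi> U V"

record 'v cnspace =
  carr :: "'v set"
  vadd :: "'v \<Rightarrow> 'v \<Rightarrow> 'v"
  vscale :: "complex \<Rightarrow> 'v \<Rightarrow> 'v"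
  vzero :: "'v"
  vnorm :: "'v \<Rightarrow> real"

definition vdist :: "'v cnspace \<Rightarrow> 'v \<Rightarrow> 'v \<Rightarrow> real" where
  "vdist X x y = vnorm X (vadd X x (vscale X (- 1) y))"

definition vtopology :: "'v cnspace \<Rightarrow> 'v topology" where
  "vtopology X = Metric_space.mtopology (carr X) (vdist X)"

locale complex_banach_space =
  fixes X :: "'v cnspace"
  assumes zero_closed: "vzero X \<in> carr X"
    and add_closed: "\<lbrakk>x \<in> carr X; y \<in> carr X\<rbrakk> \<Longrightarrow> vadd X x y \<in> carr X"
    and scale_closed: "x \<in> carr X \<Longrightarrow> vscale X c x \<in> carr X"
    and add_assoc: "\<lbrakk>x \<in> carr X; y \<in> carr X; u \<in> carr X\<rbrakk>
          \<Longrightarrow> vadd X (vadd X x y) u = vadd X x (vadd X y u)"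
    and add_commute: "\<lbrakk>x \<in> carr X; y \<in> carr X\<rbrakk> \<Longrightarrow> vadd X x y = vadd X y x"
    and add_zero: "x \<in> carr X \<Longrightarrow> vadd X x (vzero X) = x"
    and add_minus: "x \<in> carr X \<Longrightarrow> vadd X x (vscale X (- 1) x) = vzero X"
    and scale_add: "\<lbrakk>x \<in> carr X; y \<in> carr X\<rbrakk>
          \<Longrightarrow> vscale X c (vadd X x y) = vadd X (vscale X c x) (vscale X c y)"
    and add_scale: "x \<in> carr X \<Longrightarrow> vscale X (c + d) x = vadd X (vscale X c x) (vscale X d x)"
    and scale_scale: "x \<in> carr X \<Longrightarrow> vscale X c (vscale X d x) = vscale X (c * d) x"
    and scale_one: "x \<in> carr X \<Longrightarrow> vscale X 1 x = x"
    and norm_nonneg: "x \<in> carr X \<Longrightarrow> 0 \<le> vnorm X x"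
    and norm_eq_zero: "x \<in> carr X \<Longrightarrow> vnorm X x = 0 \<longleftrightarrow> x = vzero X"
    and norm_scale: "x \<in> carr X \<Longrightarrow> vnorm X (vscale X c x) = cmod c * vnorm X x"
    and norm_triangle: "\<lbrakk>x \<in> carr X; y \<in> carr X\<rbrakk> \<Longrightarrow> vnorm X (vadd X x y) \<le> vnorm X x + vnorm X y"
    and complete: "Metric_space.mcomplete (carr X) (vdist X)"

definition fun_space :: "('i \<Rightarrow> 'a::complex_banach) set \<Rightarrow> (('i \<Rightarrow> 'a) \<Rightarrow> real) \<Rightarrow> ('i \<Rightarrow> 'a) cnspace" where
  "fun_space S N = \<lparr>carr = S, vadd = (\<lambda>f g i. f i + g i), vscale = (\<lambda>c f i. c *\<^sub>C f i),
     vzero = (\<lambda>i. 0), vnorm = N\<rparr>"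

definition bounded_operator :: "'v cnspace \<Rightarrow> 'w cnspace \<Rightarrow> ('v \<Rightarrow> 'w) \<Rightarrow> bool" where
  "bounded_operator X Y T \<longleftrightarrow>
     T \<in> carr X \<rightarrow> carr Y \<and>
     (\<forall>x\<in>carr X. \<forall>y\<in>carr X. T (vadd X x y) = vadd Y (T x) (T y)) \<and>
     (\<forall>c. \<forall>x\<in>carr X. T (vscale X c x) = vscale Y c (T x)) \<and>
     (\<exists>C. \<forall>x\<in>carr X. vnorm Y (T x) \<le> C * vnorm X x)"

definition isomorphic_spaces :: "'v cnspace \<Rightarrow> 'w cnspace \<Rightarrow> bool" where
  "isomorphic_spaces X Y \<longleftrightarrow>
     (\<exists>T. bij_betw T (carr X) (carr Y) \<and> bounded_operator X Y T \<and>
          bounded_operator Y X (the_inv_into (carr X) T))"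

definition complemented_in :: "'v set \<Rightarrow> 'v cnspace \<Rightarrow> bool" where
  "complemented_in W X \<longleftrightarrow>
     (\<exists>P. bounded_operator X X P \<and> (\<forall>x\<in>carr X. P (P x) = P x) \<and> P ` carr X = W)"

definition coset :: "'v cnspace \<Rightarrow> 'v set \<Rightarrow> 'v \<Rightarrow> 'v set" where
  "coset X W x = {vadd X x w | w. w \<in> W}"

text \<open>In \<open>vscale\<close> the summand from \<open>W\<close> is only needed for the scalar 0.\<close>

definition quotient_space :: "'v cnspace \<Rightarrow> 'v set \<Rightarrow> 'v set cnspace" where
  "quotient_space X W =
     \<lparr>carr = coset X W ` carr X,
      vadd = (\<lambda>A B. {vadd X a b | a b. a \<in> A \<and> b \<in> B}),
      vscale = (\<lambda>c A. {vadd X (vscale X c a) w | a w. a \<in> A \<and> w \<in> W}),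
      vzero = W,
      vnorm = (\<lambda>A. Inf (vnorm X ` A))\<rparr>"

definition taylor_coeff :: "(complex \<Rightarrow> complex) \<Rightarrow> nat \<Rightarrow> complex" where
  "taylor_coeff f j = (deriv ^^ j) f 0 / fact j"

definition Ainf :: "(complex \<Rightarrow> complex) set" where
  "Ainf = {f. f holomorphic_on unit_disc \<and> (\<forall>w. w \<notin> unit_disc \<longrightarrow> f w = 0) \<and>
     (\<forall>\<alpha>>0. bdd_above (range (\<lambda>j. cmod (taylor_coeff f j) * (real j + 1) powr \<alpha>)))}"

definition Ainf_norm :: "real \<Rightarrow> (complex \<Rightarrow> complex) \<Rightarrow> real" where
  "Ainf_norm \<alpha> f = (SUP j. cmod (taylor_coeff f j) * (real j + 1) powr \<alpha>)"

definition Ainf_topology :: "(complex \<Rightarrow> complex) topology" where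
  "Ainf_topology = topology_generated_by
     {{g \<in> Ainf. Ainf_norm \<alpha> (\<lambda>w. g w - f w) < \<epsilon>} | f \<alpha> \<epsilon>. f \<in> Ainf \<and> \<alpha> > 0 \<and> \<epsilon> > 0}"

definition Ainf_on :: "complex set \<Rightarrow> (complex \<Rightarrow> complex) \<Rightarrow> (complex \<Rightarrow> complex) set" where
  "Ainf_on U \<phi> = pull U \<phi> ` Ainf"

definition Ainf_on_topology ::
    "complex set \<Rightarrow> (complex \<Rightarrow> complex) \<Rightarrow> (complex \<Rightarrow> complex) topology" where
  "Ainf_on_topology U \<phi> =
     pullback_topology (Ainf_on U \<phi>) (pull unit_disc (the_inv_into U \<phi>)) Ainf_topology"

text \<open>The algebra $A^\infty_U$ with its topology does not depend on the conformal equivalence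
  \<open>\<phi>\<close> used to define it, so the existential quantifier in the module condition could
  equivalently be a universal one.  Continuity refers to the product topology, that is, it is
  joint continuity of the product.\<close>

definition acceptable :: "complex set \<Rightarrow> (complex \<Rightarrow> 'a::complex_banach) cnspace \<Rightarrow> bool" where
  "acceptable U F \<longleftrightarrow>
     open U \<and>
     F = fun_space (carr F) (vnorm F) \<and>
     (\<forall>f\<in>carr F. analytic_fun U f) \<and>
     complex_banach_space F \<and>
     (\<forall>z\<in>U. continuous_map (vtopology F) euclidean (\<lambda>f. f z)) \<and>
     (\<exists>\<phi>. conformal_equiv \<phi> U unit_disc \<and>
        (\<forall>a\<in>Ainf_on U \<phi>. \<forall>f\<in>carr F. (\<lambda>u. a u *\<^sub>C f u) \<in> carr F) \<and>
        continuous_map (prod_topology (Ainf_on_topology U \<phi>) (vtopology F)) (vtopology F)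
          (\<lambda>(a, f) u. a u *\<^sub>C f u)) \<and>
     (\<forall>\<phi>. conformal_equiv \<phi> U unit_disc \<longrightarrow>
        (\<exists>K>0. \<forall>f. analytic_fun U f \<longrightarrow>
           ((\<lambda>u. \<phi> u *\<^sub>C f u) \<in> carr F \<longleftrightarrow> f \<in> carr F) \<and>
           (f \<in> carr F \<longrightarrow>
              inverse K * vnorm F (\<lambda>u. \<phi> u *\<^sub>C f u) \<le> vnorm F f \<and>
              vnorm F f \<le> K * vnorm F (\<lambda>u. \<phi> u *\<^sub>C f u))))"

text \<open>Tuples are indexed from the right: \<open>(x\<^bsub>n-1\<^esub>, \<dots>, x\<^sub>0)\<close> is the function
  \<open>j \<mapsto> x\<^sub>j\<close>, extended by 0 to all \<open>j \<ge> n\<close>.\<close>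

definition jet :: "nat \<Rightarrow> (complex \<Rightarrow> 'a::complex_banach) \<Rightarrow> complex \<Rightarrow> nat \<Rightarrow> 'a" where
  "jet n f z = (\<lambda>j. if j < n then (1 / fact j) *\<^sub>C (cderiv ^^ j) f z else 0)"

definition rochberg ::
    "(complex \<Rightarrow> 'a::complex_banach) cnspace \<Rightarrow> nat \<Rightarrow> complex \<Rightarrow> (nat \<Rightarrow> 'a) cnspace" where
  "rochberg F n z = fun_space ((\<lambda>f. jet n f z) ` carr F)
     (\<lambda>x. Inf (vnorm F ` {f \<in> carr F. jet n f z = x}))"

definition G_space :: "(complex \<Rightarrow> complex) \<Rightarrow> (complex \<Rightarrow> 'a::complex_banach) cnspace
    \<Rightarrow> (complex \<Rightarrow> 'a) cnspace" where
  "G_space \<psi> F = fun_space (pull unit_disc \<psi> ` carr F)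
     (\<lambda>g. vnorm F (the_inv_into (carr F) (pull unit_disc \<psi>) g))"

text \<open>Pairs of functions are encoded as pair-valued functions; \<open>first_minus_deriv G\<close> is
  \<open>g\<^sub>1 - g'\<close> for \<open>G = (g\<^sub>1, g)\<close>.\<close>

definition first_minus_deriv ::
    "(complex \<Rightarrow> 'a::complex_banach \<times> 'a) \<Rightarrow> complex \<Rightarrow> 'a" where
  "first_minus_deriv G = (\<lambda>w. if w \<in> unit_disc then fst (G w) - cderiv (\<lambda>v. snd (G v)) w else 0)"

definition G2_space :: "(complex \<Rightarrow> complex) \<Rightarrow> (complex \<Rightarrow> 'a::complex_banach) cnspace
    \<Rightarrow> (complex \<Rightarrow> 'a \<times> 'a) cnspace" where
  "G2_space \<psi> F = fun_space
     {G. analytic_fun unit_disc (\<lambda>w. fst (G w)) \<and> analytic_fun unit_disc (\<lambda>w. snd (G w)) \<and>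
         (\<lambda>w. snd (G w)) \<in> carr (G_space \<psi> F) \<and> first_minus_deriv G \<in> carr (G_space \<psi> F)}
     (\<lambda>G. vnorm (G_space \<psi> F) (first_minus_deriv G) + vnorm (G_space \<psi> F) (\<lambda>w. snd (G w)))"

text \<open>\<open>L_map \<psi> u\<close> is the matrix $L(u)$ as an operator on $\Sigma^2$; here \<open>w = \<psi>\<^sup>-\<^sup>1(u)\<close>.\<close>

definition L_map :: "(complex \<Rightarrow> complex) \<Rightarrow> complex \<Rightarrow> 'a::complex_banach \<times> 'a \<Rightarrow> 'a \<times> 'a" where
  "L_map \<psi> u = (\<lambda>(x1, x0). (deriv \<psi> (the_inv_into unit_disc \<psi> u) *\<^sub>C x1, x0))"

definition T_map :: "complex set \<Rightarrow> (complex \<Rightarrow> complex) \<Rightarrow>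
    (complex \<Rightarrow> 'a::complex_banach \<times> 'a) \<Rightarrow> complex \<Rightarrow> 'a \<times> 'a" where
  "T_map U \<psi> G = (\<lambda>u. if u \<in> U then inv (L_map \<psi> u) (G (the_inv_into unit_disc \<psi> u)) else 0)"

definition T_space :: "complex set \<Rightarrow> (complex \<Rightarrow> complex) \<Rightarrow>
    (complex \<Rightarrow> 'a::complex_banach) cnspace \<Rightarrow> (complex \<Rightarrow> 'a \<times> 'a) cnspace" where
  "T_space U \<psi> F = fun_space (T_map U \<psi> ` carr (G2_space \<psi> F))
     (\<lambda>t. vnorm (G2_space \<psi> F) (the_inv_into (carr (G2_space \<psi> F)) (T_map U \<psi>) t))"

definition F2_space :: "complex set \<Rightarrow> (complex \<Rightarrow> complex) \<Rightarrow>
    (complex \<Rightarrow> 'a::complex_banach) cnspace \<Rightarrow> nat \<Rightarrow> complex \<Rightarrow> (nat \<Rightarrow> 'a \<times> 'a) cnspace" where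
  "F2_space U \<psi> F m z = rochberg (T_space U \<psi> F) m z"

text \<open>Rows are numbered from the bottom, starting at 0: row \<open>j\<close> is \<open>((j + 1) x\<^bsub>j+1\<^esub>, x\<^sub>j)\<close>.\<close>

definition E2_op :: "nat \<Rightarrow> (nat \<Rightarrow> 'a::complex_banach) \<Rightarrow> nat \<Rightarrow> 'a \<times> 'a" where
  "E2_op m x = (\<lambda>j. if j < m then (of_nat (j + 1) *\<^sub>C x (j + 1), x j) else (0, 0))"

end

theory Submission
  imports Defs
begin

text \<open>Let \<open>\<phi> = \<psi>\<^sup>-\<^sup>1\<close>. The functions in \<open>\<T>\<close> are exactly the pairs \<open>(f' + \<phi>' h, f)\<close> with
  \<open>f, h \<in> F\<close>, of norm \<open>\<parallel>h\<parallel> + \<parallel>f\<parallel>\<close>; write \<open>J f h\<close> for the \<open>m\<close>-jet at \<open>z\<close> of such a pair. The range of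
  \<open>E2_op m\<close> consists of the \<open>J f 0\<close>, and \<open>J f h \<mapsto> jet (m - 1) h\<close> is well defined. For
  \<open>B h = - (\<phi> - \<phi> z) h / m\<close> the derivatives of \<open>h\<close> of order \<open>m - 1\<close> cancel in \<open>J (B h) h\<close>, which is
  therefore determined by \<open>jet (m - 1) h\<close>. Hence \<open>J f h \<mapsto> J (f - B h) 0\<close> is a bounded projection
  onto the range, and the map \<open>J f h \<mapsto> jet (m - 1) h\<close> has that range as its kernel and induces the
  isomorphism.

  That a complex differentiable function into a Banach space has derivatives of all orders is
  reduced to the scalar case by norming functionals.\<close>

section \<open>Norming functionals\<close>

text \<open>Hahn-Banach by Zorn's lemma. Partial functionals are encoded by their graphs, as
  subspaces of the product with the reals. The bound \<open>b \<le> norm a\<close> already forces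
  such a graph to be single-valued, because with (0, b) it also contains (0, -b). A one-dimensional
  extension shows that a maximal graph is total.\<close>

lemma exists_norming_linear_functional:
  fixes v :: "'a::real_normed_vector"
  shows "\<exists>u::'a \<Rightarrow> real. linear u \<and> (\<forall>x. u x \<le> norm x) \<and> u v = norm v"
proof -
  define A where "A = {G::('a \<times> real) set. subspace G \<and> (v, norm v) \<in> G \<and> (\<forall>(a,b)\<in>G. b \<le> norm a)}"
  have "\<exists>M\<in>A. \<forall>X\<in>A. M \<subseteq> X \<longrightarrow> X = M"
  proof (rule subset_Zorn_nonempty)
    have "span {(v, norm v)} \<in> A"
    proof -
      have "b \<le> norm a" if "(a, b) \<in> span {(v, norm v)}" for a b
        using that by (auto simp: span_singleton mult_right_mono)
      then show ?thesis by (auto simp: A_def intro: span_base)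
    qed
    then show "A \<noteq> {}" by blast
  next
    fix C assume C: "C \<noteq> {}" "subset.chain A C"
    then have CA: "C \<subseteq> A" and lin: "\<And>X Y. X \<in> C \<Longrightarrow> Y \<in> C \<Longrightarrow> X \<subseteq> Y \<or> Y \<subseteq> X"
      by (auto simp: subset_chain_def)
    have subC: "subspace X" if "X \<in> C" for X using CA that by (auto simp: A_def)
    have "subspace (\<Union>C)"
      unfolding subspace_def
    proof (intro conjI ballI allI)
      obtain X where "X \<in> C" using C(1) by blast
      then show "0 \<in> \<Union>C" using subC subspace_0 by blast
    next
      fix x y assume "x \<in> \<Union>C" "y \<in> \<Union>C"
      then obtain X where "X \<in> C" "x \<in> X" "y \<in> X" using lin by blast
      then show "x + y \<in> \<Union>C" using subC subspace_add by blast
    next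
      fix c :: real and x assume "x \<in> \<Union>C"
      then show "c *\<^sub>R x \<in> \<Union>C" using subC subspace_scale by blast
    qed
    then show "\<Union>C \<in> A" using C(1) CA by (auto simp: A_def)
  qed
  then obtain M where M: "M \<in> A" and max: "\<And>X. X \<in> A \<Longrightarrow> M \<subseteq> X \<Longrightarrow> X = M" by blast
  have sub: "subspace M" and vM: "(v, norm v) \<in> M" and le: "\<And>a b. (a, b) \<in> M \<Longrightarrow> b \<le> norm a"
    using M by (auto simp: A_def)
  have total: "\<exists>b. (x, b) \<in> M" for x
  proof -
    \<comment> \<open>An admissible value at x must lie above all numbers in S and below all numbers
      \<open>norm (a' + x) - b'\<close>; \<open>key\<close> says that these requirements are
      compatible, and s is the least choice.\<close>
    define S where "S = (\<lambda>(a, b). b - norm (a - x)) ` M"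
    define s where "s = Sup S"
    have key: "b - norm (a - x) \<le> norm (a' + x) - b'" if "(a, b) \<in> M" "(a', b') \<in> M" for a b a' b'
    proof -
      have "(a + a', b + b') \<in> M" using subspace_add[OF sub that] by simp
      then have "b + b' \<le> norm (a + a')" by (rule le)
      also have "\<dots> \<le> norm (a - x) + norm (a' + x)"
        using norm_triangle_ineq[of "a - x" "a' + x"] by simp
      finally show ?thesis by simp
    qed
    have ne: "S \<noteq> {}" using vM by (auto simp: S_def)
    have bdd: "bdd_above S" using key[OF _ vM] by (force simp: S_def bdd_above_def)
    have lo: "b - norm (a - x) \<le> s" if "(a, b) \<in> M" for a b
      unfolding s_def by (rule cSup_upper[OF _ bdd]) (use that in \<open>force simp: S_def\<close>)
    have hi: "s \<le> norm (a + x) - b" if "(a, b) \<in> M" for a b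
      unfolding s_def by (rule cSup_least[OF ne]) (use key[OF _ that] in \<open>auto simp: S_def\<close>)
    \<comment> \<open>Dividing by the absolute value of t reduces this to t = 1 and t = -1, which
      are \<open>hi\<close> and \<open>lo\<close>.\<close>
    have bound: "b + t * s \<le> norm (a + t *\<^sub>R x)" if ab: "(a, b) \<in> M" for a b t
    proof -
      consider "t = 0" | "t > 0" | "t < 0" by linarith
      then show ?thesis
      proof cases
        case 1 then show ?thesis using le[OF ab] by simp
      next
        case 2
        have "((1/t) *\<^sub>R a, b / t) \<in> M" using subspace_scale[OF sub ab, of "1/t"] by simp
        then have "s + b / t \<le> norm ((1/t) *\<^sub>R a + x)" using hi by fastforce
        then have "t * (s + b / t) \<le> t * norm ((1/t) *\<^sub>R a + x)" using 2 by simp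
        also have "\<dots> = norm (t *\<^sub>R ((1/t) *\<^sub>R a + x))" using 2 by simp
        also have "t *\<^sub>R ((1/t) *\<^sub>R a + x) = a + t *\<^sub>R x" using 2 by (simp add: scaleR_add_right)
        also have "t * (s + b / t) = b + t * s" using 2 by (simp add: field_simps)
        finally show ?thesis .
      next
        case 3
        have "((-1/t) *\<^sub>R a, - b / t) \<in> M" using subspace_scale[OF sub ab, of "-1/t"] by simp
        then have "- b / t - s \<le> norm ((-1/t) *\<^sub>R a - x)" using lo by fastforce
        then have "(-t) * (- b / t - s) \<le> (-t) * norm ((-1/t) *\<^sub>R a - x)"
          using 3 by (intro mult_left_mono) auto
        also have "\<dots> = norm ((-t) *\<^sub>R ((-1/t) *\<^sub>R a - x))" using 3 by simp
        also have "(-t) *\<^sub>R ((-1/t) *\<^sub>R a - x) = a + t *\<^sub>R x" using 3 by (simp add: scaleR_diff_right)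
        also have "(-t) * (- b / t - s) = b + t * s" using 3 by (simp add: field_simps)
        finally show ?thesis .
      qed
    qed
    have "span (insert (x, s) M) \<in> A"
    proof -
      have "b \<le> norm a" if "(a, b) \<in> span (insert (x, s) M)" for a b
      proof -
        obtain k where "(a, b) - k *\<^sub>R (x, s) \<in> span M"
          using \<open>(a, b) \<in> span (insert (x, s) M)\<close> unfolding span_breakdown_eq by blast
        then have "(a - k *\<^sub>R x, b - k * s) \<in> M" using sub by (simp add: span_eq_iff[THEN iffD2])
        from bound[OF this, of k] show ?thesis by simp
      qed
      moreover have "(v, norm v) \<in> span (insert (x, s) M)" using vM by (simp add: span_base)
      ultimately show ?thesis by (auto simp: A_def)
    qed
    then have "span (insert (x, s) M) = M" using max span_superset[of "insert (x, s) M"] by blast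
    then have "(x, s) \<in> M" using span_base[of "(x, s)" "insert (x, s) M"] by simp
    then show ?thesis ..
  qed
  have single: "b = b'" if "(a, b) \<in> M" "(a, b') \<in> M" for a b b'
    using le[of 0 "b - b'"] le[of 0 "b' - b"] subspace_diff[OF sub that] subspace_diff[OF sub that(2) that(1)]
    by simp
  define u where "u x = (SOME b. (x, b) \<in> M)" for x
  have uM: "(x, u x) \<in> M" for x
    unfolding u_def by (rule someI_ex) (rule total)
  have "linear u"
  proof
    fix x y
    show "u (x + y) = u x + u y" using single[OF uM] subspace_add[OF sub uM[of x] uM[of y]] by simp
  next
    fix r x
    show "u (r *\<^sub>R x) = r *\<^sub>R u x" using single[OF uM] subspace_scale[OF sub uM[of x], of r] by simp
  qed
  then show ?thesis using uM le single vM by blast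
qed

text \<open>A real functional u is the real part of exactly one complex functional, x \<mapsto> u x
  - i u (i x). The norm bound passes from u to it by rotating its value onto the positive real
  axis.\<close>

lemma exists_norming_complex_functional:
  fixes v :: "'a::complex_banach"
  obtains p :: "'a \<Rightarrow> complex" where "\<And>x y. p (x + y) = p x + p y" "\<And>c x. p (c *\<^sub>C x) = c * p x"
    "\<And>x. cmod (p x) \<le> norm x" "norm v \<le> cmod (p v)"
proof -
  obtain u :: "'a \<Rightarrow> real" where lin: "linear u" and ule: "\<And>x. u x \<le> norm x" and uv: "u v = norm v"
    using exists_norming_linear_functional[of v] by blast
  define p where "p x = Complex (u x) (- u (\<i> *\<^sub>C x))" for x
  have add: "p (x + y) = p x + p y" for x y
    by (simp add: p_def scaleC_add_right linear_add[OF lin] complex_eq_iff)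
  have "p (Complex r s *\<^sub>C x) = Complex r s * p x" for r s x
  proof -
    have C: "Complex r s = of_real r + of_real s * \<i>" by (simp add: complex_eq_iff)
    have 1: "Complex r s *\<^sub>C x = r *\<^sub>R x + s *\<^sub>R (\<i> *\<^sub>C x)"
      by (simp add: C scaleC_add_left scaleR_scaleC scaleC_scaleC)
    have ii: "\<i> *\<^sub>C \<i> *\<^sub>C x = (- 1) *\<^sub>R x" by (simp add: scaleR_scaleC scaleC_scaleC)
    have com: "\<i> *\<^sub>C (t *\<^sub>R y) = t *\<^sub>R (\<i> *\<^sub>C y)" for t and y :: 'a
      by (simp add: scaleR_scaleC scaleC_scaleC mult.commute)
    show ?thesis
      unfolding 1 p_def scaleC_add_right com linear_add[OF lin] linear_scale[OF lin] ii
      by (simp add: complex_eq_iff algebra_simps)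
  qed
  then have scale: "p (c *\<^sub>C x) = c * p x" for c x by (cases c) simp
  have "cmod (p x) \<le> norm x" for x
  proof (cases "p x = 0")
    case False
    \<comment> \<open>The unimodular factor that makes \<open>c * p x\<close> real and nonnegative,
      so that it equals \<open>u (c *\<^sub>C x)\<close>.\<close>
    define c where "c = cnj (sgn (p x))"
    have "cmod c = 1" using False by (simp add: c_def norm_sgn)
    have "c * p x = cmod (p x)"
      using False by (simp add: c_def sgn_div_norm scaleR_conv_of_real mult.commute[of "cnj _"]
          complex_norm_square[symmetric] power2_eq_square field_simps)
    then have "cmod (p x) = Re (p (c *\<^sub>C x))" by (simp add: scale)
    also have "\<dots> \<le> norm (c *\<^sub>C x)" by (simp add: p_def ule)
    finally show ?thesis by (simp add: norm_scaleC \<open>cmod c = 1\<close>)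
  qed simp
  moreover have "norm v \<le> cmod (p v)" using complex_Re_le_cmod[of "p v"] uv by (simp add: p_def)
  ultimately show ?thesis using that add scale by blast
qed

section \<open>Complex differentiation in Banach spaces\<close>

lemma bounded_bilinear_scaleC: "bounded_bilinear (scaleC :: complex \<Rightarrow> 'a::complex_banach \<Rightarrow> 'a)"
proof
  fix c d :: complex and x y :: 'a and r :: real
  show "(c + d) *\<^sub>C x = c *\<^sub>C x + d *\<^sub>C x" by (rule scaleC_add_left)
  show "c *\<^sub>C (x + y) = c *\<^sub>C x + c *\<^sub>C y" by (rule scaleC_add_right)
  show "(r *\<^sub>R c) *\<^sub>C x = r *\<^sub>R (c *\<^sub>C x)" by (simp add: scaleR_scaleC scaleC_scaleC scaleR_conv_of_real)
  show "c *\<^sub>C (r *\<^sub>R x) = r *\<^sub>R (c *\<^sub>C x)" by (simp add: scaleR_scaleC scaleC_scaleC mult.commute)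
  show "\<exists>K. \<forall>(c::complex) x::'a. norm (c *\<^sub>C x) \<le> norm c * norm x * K"
    by (rule exI[of _ 1]) (simp add: norm_scaleC)
qed

lemmas scaleC_zero_left [simp] = bounded_bilinear.zero_left[OF bounded_bilinear_scaleC]
  and scaleC_zero_right [simp] = bounded_bilinear.zero_right[OF bounded_bilinear_scaleC]
  and scaleC_minus_left = bounded_bilinear.minus_left[OF bounded_bilinear_scaleC]
  and scaleC_diff_left = bounded_bilinear.diff_left[OF bounded_bilinear_scaleC]
  and scaleC_diff_right = bounded_bilinear.diff_right[OF bounded_bilinear_scaleC]
  and bounded_linear_scaleC_left = bounded_bilinear.bounded_linear_left[OF bounded_bilinear_scaleC]

lemma scaleC_minus_one: "(- 1) *\<^sub>C x = - (x::'a::complex_banach)"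
  by (simp add: scaleC_minus_left scaleC_one)

lemma scaleC_eq_0_iff: "c *\<^sub>C x = 0 \<longleftrightarrow> c = 0 \<or> (x::'a::complex_banach) = 0"
  by (metis mult_eq_0_iff norm_eq_zero norm_scaleC)

lemma has_cderiv_unique: "has_cderiv f D z \<Longrightarrow> has_cderiv f D' z \<Longrightarrow> D = D'"
  unfolding has_cderiv_def by (drule (1) has_derivative_unique) (metis scaleC_one)

lemma cderiv_eq: "has_cderiv f D z \<Longrightarrow> cderiv f z = D"
  unfolding cderiv_def by (metis has_cderiv_unique someI)

lemma has_cderiv_cderiv: "has_cderiv f D z \<Longrightarrow> has_cderiv f (cderiv f z) z"
  by (simp add: cderiv_eq)

lemma has_cderiv_transform:
  assumes "open U" "z \<in> U" "\<And>u. u \<in> U \<Longrightarrow> f u = g u" "has_cderiv f D z"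
  shows "has_cderiv g D z"
  using assms has_derivative_transform_within_open unfolding has_cderiv_def by metis

lemma cderiv_cong_open:
  assumes "open U" "z \<in> U" "\<And>u. u \<in> U \<Longrightarrow> f u = g u"
  shows "cderiv f z = cderiv g z"
proof -
  have "has_cderiv f D z \<longleftrightarrow> has_cderiv g D z" for D
    using has_cderiv_transform[of U z] assms by metis
  then show ?thesis by (simp add: cderiv_def)
qed

lemma has_cderiv_add:
  "has_cderiv f D z \<Longrightarrow> has_cderiv g E z \<Longrightarrow> has_cderiv (\<lambda>u. f u + g u) (D + E) z"
  unfolding has_cderiv_def scaleC_add_right by (rule has_derivative_add)

lemma has_cderiv_const: "has_cderiv (\<lambda>u. c) 0 z"
  unfolding has_cderiv_def by simp

lemma has_cderiv_scale:
  assumes "(a has_field_derivative a') (at z)" "has_cderiv f D z"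
  shows "has_cderiv (\<lambda>u. a u *\<^sub>C f u) (a z *\<^sub>C D + a' *\<^sub>C f z) z"
proof -
  have "((\<lambda>u. a u *\<^sub>C f u) has_derivative (\<lambda>h. a z *\<^sub>C (h *\<^sub>C D) + (a' * h) *\<^sub>C f z)) (at z)"
    by (rule bounded_bilinear.FDERIV[OF bounded_bilinear_scaleC])
      (use assms in \<open>auto simp: has_cderiv_def has_field_derivative_def\<close>)
  then show ?thesis
    by (simp add: has_cderiv_def scaleC_add_right scaleC_scaleC mult.commute)
qed

lemma has_cderiv_cmult: "has_cderiv f D z \<Longrightarrow> has_cderiv (\<lambda>u. c *\<^sub>C f u) (c *\<^sub>C D) z"
  using has_cderiv_scale[of "\<lambda>_. c" 0 z f D] by simp

lemma has_cderiv_Pair: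
  "has_cderiv f D z \<Longrightarrow> has_cderiv g E z \<Longrightarrow> has_cderiv (\<lambda>u. (f u, g u)) (D, E) z"
  unfolding has_cderiv_def scaleC_prod_def by (simp add: has_derivative_Pair)

lemma has_cderiv_compose:
  assumes "(h has_field_derivative h') (at w)" "has_cderiv f D (h w)"
  shows "has_cderiv (\<lambda>u. f (h u)) (h' *\<^sub>C D) w"
proof -
  have "((\<lambda>u. f (h u)) has_derivative (\<lambda>k. (h' * k) *\<^sub>C D)) (at w)"
    using has_derivative_compose[of h "(*) h'" w UNIV f "\<lambda>k. k *\<^sub>C D"] assms
    by (simp add: has_cderiv_def has_field_derivative_def)
  then show ?thesis by (simp add: has_cderiv_def scaleC_scaleC mult.commute)
qed

text \<open>In contrast to \<open>analytic_fun\<close> nothing is required outside U. There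
  \<open>cderiv f\<close> is an arbitrary choice, and functions such as f \<circ> \<psi> need not
  vanish.\<close>

definition cdiff_on :: "complex set \<Rightarrow> (complex \<Rightarrow> 'a::complex_banach) \<Rightarrow> bool" where
  "cdiff_on U f \<longleftrightarrow> (\<forall>z\<in>U. \<exists>D. has_cderiv f D z)"

lemma cdiff_onD: "cdiff_on U f \<Longrightarrow> z \<in> U \<Longrightarrow> has_cderiv f (cderiv f z) z"
  unfolding cdiff_on_def using has_cderiv_cderiv by blast

lemma analytic_fun_iff: "analytic_fun U f \<longleftrightarrow> cdiff_on U f \<and> (\<forall>z. z \<notin> U \<longrightarrow> f z = 0)"
  by (simp add: analytic_fun_def cdiff_on_def)

text \<open>First-order Taylor formula for \<open>deriv g\<close>, with the third derivative of g
  bounded by Cauchy's estimate on discs of radius r / 2 centred in \<open>ball a (r / 4)\<close>.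
  The bound depends on g only through B and r, hence is uniform over all p \<circ> f with
  functionals p of norm at most 1.\<close>

lemma deriv_difference_quotient_bound:
  fixes g :: "complex \<Rightarrow> complex"
  assumes hol: "g holomorphic_on ball a r" and bd: "\<And>w. w \<in> ball a r \<Longrightarrow> cmod (g w) < B" and "r > 0"
    and h: "h \<noteq> 0" "cmod h < r / 4"
  shows "cmod ((deriv g (a + h) - deriv g a) / h - deriv (deriv g) a) \<le> 6 * B / (r / 2) ^ 3 * cmod h"
proof -
  define S where "S = ball a (r / 4)"
  have S: "a \<in> S" "a + h \<in> S" using h \<open>r > 0\<close> by (auto simp: S_def dist_norm)
  have sub: "S \<subseteq> ball a r" using \<open>r > 0\<close> by (auto simp: S_def)
  have L: "cmod ((deriv ^^ 3) g w) \<le> 6 * B / (r / 2) ^ 3" if "w \<in> S" for w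
  proof -
    have s: "cball w (r / 2) \<subseteq> ball a r"
    proof
      fix y assume "y \<in> cball w (r / 2)"
      then show "y \<in> ball a r"
        using that dist_triangle[of a y w] \<open>r > 0\<close> by (auto simp: S_def)
    qed
    then have s': "ball w (r / 2) \<subseteq> ball a r" using ball_subset_cball by blast
    have "cmod ((deriv ^^ 3) g w) \<le> fact 3 * B / (r / 2) ^ 3"
    proof (rule Cauchy_higher_deriv_bound)
      show "g holomorphic_on ball w (r / 2)" using hol s' holomorphic_on_subset by blast
      show "continuous_on (cball w (r / 2)) g"
        using hol s holomorphic_on_imp_continuous_on continuous_on_subset by blast
      show "\<And>x. x \<in> ball w (r / 2) \<Longrightarrow> g x \<in> ball 0 B" using bd s' by auto
    qed (use \<open>r > 0\<close> in auto)
    then show ?thesis by (simp add: fact_numeral)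
  qed
  have "cmod ((deriv ^^ Suc 0) g (a + h) - (\<Sum>i\<le>1. (deriv ^^ Suc i) g a * ((a + h) - a) ^ i / fact i))
      \<le> 6 * B / (r / 2) ^ 3 * cmod ((a + h) - a) ^ Suc 1 / fact 1"
  proof (rule complex_Taylor[where S = S and f = "\<lambda>i. (deriv ^^ Suc i) g"])
    fix i x assume "x \<in> S"
    have "(deriv ^^ Suc i) g holomorphic_on ball a r" by (rule holomorphic_higher_deriv[OF hol]) simp
    then show "((deriv ^^ Suc i) g has_field_derivative (deriv ^^ Suc (Suc i)) g x) (at x within S)"
      using holomorphic_derivI[of "(deriv ^^ Suc i) g" "ball a r" x] \<open>x \<in> S\<close> sub
      by (auto intro: has_field_derivative_at_within)
  next
    fix x assume "x \<in> S" then show "cmod ((deriv ^^ Suc (Suc 1)) g x) \<le> 6 * B / (r / 2) ^ 3"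
      using L[of x] by (simp add: numeral_3_eq_3)
  qed (use S in \<open>auto simp: S_def\<close>)
  then have "cmod (deriv g (a + h) - deriv g a - deriv (deriv g) a * h) \<le> (6 * B / (r / 2) ^ 3) * cmod h ^ 2"
    by (simp add: power2_eq_square algebra_simps)
  moreover have "(deriv g (a + h) - deriv g a) / h - deriv (deriv g) a
      = (deriv g (a + h) - deriv g a - deriv (deriv g) a * h) / h" using h(1) by (simp add: field_simps)
  ultimately show ?thesis using h(1)
    by (simp add: norm_divide divide_le_eq power2_eq_square mult.assoc)
qed

text \<open>Norming functionals carry the scalar estimate for difference quotients over to vector-valued
  functions, where it makes the quotients Cauchy.\<close>

theorem cdiff_on_cderiv:
  fixes f :: "complex \<Rightarrow> 'a::complex_banach"
  assumes "open U" "cdiff_on U f"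
  shows "cdiff_on U (cderiv f)"
  unfolding cdiff_on_def
proof
  fix a assume "a \<in> U"
  \<comment> \<open>Continuity at a bounds f on a small disc; this provides the common bound B and
    radius r for all scalar functions p \<circ> f.\<close>
  have "isCont f a" using cdiff_onD[OF assms(2) \<open>a \<in> U\<close>] has_derivative_continuous unfolding has_cderiv_def by blast
  then obtain d where "d > 0" and d: "\<And>w. dist w a < d \<Longrightarrow> dist (f w) (f a) < 1"
    unfolding continuous_at_eps_delta by (metis zero_less_one)
  obtain e where "e > 0" and e: "ball a e \<subseteq> U" using assms(1) \<open>a \<in> U\<close> open_contains_ball by blast
  define r where "r = min d e"
  define B where "B = norm (f a) + 1"
  define L where "L = 6 * B / (r / 2) ^ 3"
  have "r > 0" using \<open>d > 0\<close> \<open>e > 0\<close> by (simp add: r_def)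
  have "L \<ge> 0" using \<open>r > 0\<close> by (simp add: L_def B_def)
  have rU: "ball a r \<subseteq> U" using e by (auto simp: r_def)
  have B: "norm (f w) < B" if "w \<in> ball a r" for w
    using that d[of w] norm_triangle_ineq2[of "f w" "f a"] by (auto simp: r_def B_def dist_norm norm_minus_commute)
  define q where "q h = (1 / h) *\<^sub>C (cderiv f (a + h) - cderiv f a)" for h
  have q: "norm (q h - q k) \<le> L * (cmod h + cmod k)"
    if hk: "h \<noteq> 0" "cmod h < r / 4" "k \<noteq> 0" "cmod k < r / 4" for h k
  proof -
    \<comment> \<open>The functional depends on h and k, but the bound in \<open>pq\<close> does
      not. The scalar second derivative c cancels when the quotients for h and k are
      compared.\<close>
    obtain p :: "'a \<Rightarrow> complex" where add: "\<And>x y. p (x + y) = p x + p y"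
      and scale: "\<And>c x. p (c *\<^sub>C x) = c * p x"
      and ple: "\<And>x. cmod (p x) \<le> norm x" and pv: "norm (q h - q k) \<le> cmod (p (q h - q k))"
      using exists_norming_complex_functional by blast
    have diff: "p (x - y) = p x - p y" for x y
      using add[of "x - y" y] by (simp add: algebra_simps)
    have bl: "bounded_linear p"
      by (rule bounded_linear_intro[of _ 1])
        (use add ple scale in \<open>auto simp: scaleR_scaleC scaleR_conv_of_real\<close>)
    have der: "((\<lambda>w. p (f w)) has_field_derivative p (cderiv f w)) (at w)" if "w \<in> ball a r" for w
    proof -
      have "(f has_derivative (\<lambda>h. h *\<^sub>C cderiv f w)) (at w)"
        using cdiff_onD[OF assms(2)] that rU unfolding has_cderiv_def by blast
      from bounded_linear.has_derivative[OF bl this] show ?thesis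
        by (simp add: has_field_derivative_def scale mult.commute[of _ "p _"])
    qed
    have hol: "(\<lambda>w. p (f w)) holomorphic_on ball a r"
      unfolding holomorphic_on_def field_differentiable_def
      using der has_field_derivative_at_within by blast
    have bd: "cmod (p (f w)) < B" if "w \<in> ball a r" for w
      using B[OF that] ple[of "f w"] by simp
    define c where "c = deriv (deriv (\<lambda>w. p (f w))) a"
    have pq: "cmod (p (q j) - c) \<le> L * cmod j" if "j \<noteq> 0" "cmod j < r / 4" for j
    proof -
      have "deriv (\<lambda>w. p (f w)) (a + j) = p (cderiv f (a + j))" "deriv (\<lambda>w. p (f w)) a = p (cderiv f a)"
        using that \<open>r > 0\<close> by (auto intro!: DERIV_imp_deriv der simp: dist_norm)
      then have "p (q j) = (deriv (\<lambda>w. p (f w)) (a + j) - deriv (\<lambda>w. p (f w)) a) / j"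
        by (simp add: q_def scale diff)
      then show ?thesis
        using deriv_difference_quotient_bound[OF hol bd \<open>r > 0\<close> that] by (simp add: L_def c_def)
    qed
    have "cmod (p (q h - q k)) \<le> cmod (p (q h) - c) + cmod (p (q k) - c)"
      using norm_triangle_ineq4[of "p (q h) - c" "p (q k) - c"] by (simp add: diff)
    also have "\<dots> \<le> L * cmod h + L * cmod k" using pq hk by (intro add_mono) auto
    finally show ?thesis using pv by (simp add: distrib_left)
  qed
  \<comment> \<open>Nonzero increments tending to 0; the shift by 2 keeps all of them strictly below
    r / 4.\<close>
  define s where "s n = complex_of_real (r / 4 * inverse (real (n + 2)))" for n :: nat
  have s0: "s n \<noteq> 0" and s1: "cmod (s n) < r / 4" for n
  proof -
    have "0 < r / 4 * inverse (real (n + 2))" "r / 4 * inverse (real (n + 2)) < r / 4"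
      using \<open>r > 0\<close> by (simp_all add: inverse_less_1_iff)
    then show "s n \<noteq> 0" "cmod (s n) < r / 4" unfolding s_def norm_of_real of_real_eq_0_iff by auto
  qed
  have slim: "(\<lambda>n. cmod (s n)) \<longlonglongrightarrow> 0"
  proof -
    have "(\<lambda>n. r / 4 * inverse (real (n + 2))) \<longlonglongrightarrow> r / 4 * 0"
      by (intro tendsto_mult tendsto_const LIMSEQ_ignore_initial_segment lim_inverse_n)
    moreover have "cmod (s n) = r / 4 * inverse (real (n + 2))" for n
      using \<open>r > 0\<close> unfolding s_def norm_of_real by simp
    ultimately show ?thesis by (simp only: mult_zero_right)
  qed
  have "Cauchy (\<lambda>n. q (s n))"
  proof (rule metric_CauchyI)
    fix e :: real assume "e > 0"
    \<comment> \<open>With this denominator the final bound is 2 L e / (2 L + 1) < e, also for L =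
      0.\<close>
    then have "\<forall>\<^sub>F n in sequentially. cmod (s n) < e / (2 * L + 1) "
      using slim \<open>L \<ge> 0\<close> by (intro order_tendstoD(2)[OF slim]) auto
    then obtain N where N: "\<And>n. n \<ge> N \<Longrightarrow> cmod (s n) < e / (2 * L + 1)"
      unfolding eventually_sequentially by blast
    have "dist (q (s m)) (q (s n)) < e" if "m \<ge> N" "n \<ge> N" for m n
    proof -
      have "norm (q (s m) - q (s n)) \<le> L * (cmod (s m) + cmod (s n))" using q s0 s1 by blast
      also have "\<dots> \<le> L * (e / (2 * L + 1) + e / (2 * L + 1))"
        using N[OF that(1)] N[OF that(2)] \<open>L \<ge> 0\<close> by (intro mult_left_mono) auto
      also have "\<dots> = 2 * L * e / (2 * L + 1)" by (simp add: field_simps)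
      also have "\<dots> < e" using \<open>L \<ge> 0\<close> \<open>e > 0\<close> by (simp add: divide_less_eq algebra_simps)
      finally show ?thesis by (simp add: dist_norm)
    qed
    then show "\<exists>M. \<forall>m\<ge>M. \<forall>n\<ge>M. dist (q (s m)) (q (s n)) < e" by blast
  qed
  then obtain D where D: "(\<lambda>n. q (s n)) \<longlonglongrightarrow> D" using Cauchy_convergent convergent_def by blast
  \<comment> \<open>Letting k run through \<open>s n\<close> in the estimate \<open>q\<close> yields
    convergence along every h \<rightarrow> 0, not only along the sequence.\<close>
  have qD: "norm (q h - D) \<le> L * cmod h" if "h \<noteq> 0" "cmod h < r / 4" for h
  proof (rule LIMSEQ_le)
    show "(\<lambda>n. norm (q h - q (s n))) \<longlonglongrightarrow> norm (q h - D)" by (intro tendsto_intros D)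
    have "(\<lambda>n. L * (cmod h + cmod (s n))) \<longlonglongrightarrow> L * (cmod h + 0)" by (intro tendsto_intros slim)
    then show "(\<lambda>n. L * (cmod h + cmod (s n))) \<longlonglongrightarrow> L * cmod h" by simp
    show "\<exists>N. \<forall>n\<ge>N. norm (q h - q (s n)) \<le> L * (cmod h + cmod (s n))" using q that s0 s1 by blast
  qed
  have "has_cderiv (cderiv f) D a"
    unfolding has_cderiv_def has_derivative_at
  proof (intro conjI)
    show "bounded_linear (\<lambda>h. h *\<^sub>C D)" by (rule bounded_linear_scaleC_left)
    have bnd: "norm (norm (cderiv f (a + h) - cderiv f a - h *\<^sub>C D) / cmod h) \<le> L * cmod h"
      if "h \<noteq> 0" "cmod h < r / 4" for h
    proof -
      have "cderiv f (a + h) - cderiv f a - h *\<^sub>C D = h *\<^sub>C (q h - D)"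
        using that(1) by (simp add: q_def scaleC_diff_right scaleC_scaleC scaleC_one)
      then show ?thesis using qD[OF that] that(1) by (simp add: norm_scaleC)
    qed
    show "(\<lambda>h. norm (cderiv f (a + h) - cderiv f a - h *\<^sub>C D) / norm h) \<midarrow>0\<rightarrow> 0"
    proof (rule Lim_null_comparison)
      show "\<forall>\<^sub>F h in at 0. norm (norm (cderiv f (a + h) - cderiv f a - h *\<^sub>C D) / norm h) \<le> L * cmod h"
        unfolding eventually_at using bnd \<open>r > 0\<close> by (intro exI[of _ "r / 4"]) (auto simp: dist_norm)
      have "(\<lambda>h::complex. L * cmod h) \<midarrow>0\<rightarrow> L * cmod 0" by (intro tendsto_intros)
      then show "(\<lambda>h::complex. L * cmod h) \<midarrow>0\<rightarrow> 0" by simp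
    qed
  qed
  then show "\<exists>D. has_cderiv (cderiv f) D a" ..
qed

section \<open>Higher derivatives of sums, multiples, pairs and products\<close>

lemma cdiff_on_higher_cderiv: "open U \<Longrightarrow> cdiff_on U f \<Longrightarrow> cdiff_on U ((cderiv ^^ n) f)"
  by (induction n) (auto intro: cdiff_on_cderiv)

lemma higher_cderiv_cong:
  assumes "open U" "\<And>u. u \<in> U \<Longrightarrow> f u = g u" "z \<in> U"
  shows "(cderiv ^^ n) f z = (cderiv ^^ n) g z"
  using assms(3)
  by (induction n arbitrary: z) (auto simp: assms(2) intro!: cderiv_cong_open[OF assms(1)])

lemma cdiff_on_cong: "open U \<Longrightarrow> (\<And>u. u \<in> U \<Longrightarrow> f u = g u) \<Longrightarrow> cdiff_on U f \<Longrightarrow> cdiff_on U g"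
  unfolding cdiff_on_def using has_cderiv_transform by metis

lemma cdiff_on_add: "cdiff_on U f \<Longrightarrow> cdiff_on U g \<Longrightarrow> cdiff_on U (\<lambda>u. f u + g u)"
  unfolding cdiff_on_def using has_cderiv_add by blast

lemma cdiff_on_scale: "open U \<Longrightarrow> a holomorphic_on U \<Longrightarrow> cdiff_on U f \<Longrightarrow> cdiff_on U (\<lambda>u. a u *\<^sub>C f u)"
  unfolding cdiff_on_def using has_cderiv_scale holomorphic_derivI by blast

lemma higher_cderiv_add:
  assumes "open U" "cdiff_on U f" "cdiff_on U g" "z \<in> U"
  shows "(cderiv ^^ n) (\<lambda>u. f u + g u) z = (cderiv ^^ n) f z + (cderiv ^^ n) g z"
  using assms(4)
proof (induction n arbitrary: z)
  case (Suc n)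
  have "cderiv ((cderiv ^^ n) (\<lambda>u. f u + g u)) z = cderiv (\<lambda>u. (cderiv ^^ n) f u + (cderiv ^^ n) g u) z"
    using Suc by (intro cderiv_cong_open[OF assms(1)]) auto
  also have "\<dots> = cderiv ((cderiv ^^ n) f) z + cderiv ((cderiv ^^ n) g) z"
    using Suc.prems assms by (intro cderiv_eq has_cderiv_add cdiff_onD[of U] cdiff_on_higher_cderiv)
  finally show ?case by simp
qed simp

lemma higher_cderiv_cmult:
  assumes "open U" "cdiff_on U f" "z \<in> U"
  shows "(cderiv ^^ n) (\<lambda>u. c *\<^sub>C f u) z = c *\<^sub>C (cderiv ^^ n) f z"
  using assms(3)
proof (induction n arbitrary: z)
  case (Suc n)
  have "cderiv ((cderiv ^^ n) (\<lambda>u. c *\<^sub>C f u)) z = cderiv (\<lambda>u. c *\<^sub>C (cderiv ^^ n) f u) z"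
    using Suc by (intro cderiv_cong_open[OF assms(1)]) auto
  also have "\<dots> = c *\<^sub>C cderiv ((cderiv ^^ n) f) z"
    using Suc.prems assms by (intro cderiv_eq has_cderiv_cmult cdiff_onD[of U] cdiff_on_higher_cderiv)
  finally show ?case by simp
qed simp

lemma higher_cderiv_Pair:
  assumes "open U" "cdiff_on U f" "cdiff_on U g" "z \<in> U"
  shows "(cderiv ^^ n) (\<lambda>u. (f u, g u)) z = ((cderiv ^^ n) f z, (cderiv ^^ n) g z)"
  using assms(4)
proof (induction n arbitrary: z)
  case (Suc n)
  have "cderiv ((cderiv ^^ n) (\<lambda>u. (f u, g u))) z = cderiv (\<lambda>u. ((cderiv ^^ n) f u, (cderiv ^^ n) g u)) z"
    using Suc by (intro cderiv_cong_open[OF assms(1)]) auto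
  also have "\<dots> = (cderiv ((cderiv ^^ n) f) z, cderiv ((cderiv ^^ n) g) z)"
    using Suc.prems assms by (intro cderiv_eq has_cderiv_Pair cdiff_onD[of U] cdiff_on_higher_cderiv)
  finally show ?case by simp
qed simp

lemma has_cderiv_sum:
  "(\<And>i. i \<in> I \<Longrightarrow> has_cderiv (f i) (D i) z) \<Longrightarrow> has_cderiv (\<lambda>u. \<Sum>i\<in>I. f i u) (\<Sum>i\<in>I. D i) z"
  by (induction I rule: infinite_finite_induct) (auto intro: has_cderiv_add has_cderiv_const)

text \<open>Leibniz rule, by induction with Pascal's identity.\<close>

lemma higher_cderiv_scale:
  assumes "open U" "a holomorphic_on U" "cdiff_on U f" "z \<in> U"
  shows "(cderiv ^^ n) (\<lambda>u. a u *\<^sub>C f u) z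
    = (\<Sum>i\<le>n. (of_nat (n choose i) * (deriv ^^ i) a z) *\<^sub>C (cderiv ^^ (n - i)) f z)"
  using assms(4)
proof (induction n arbitrary: z)
  case (Suc n)
  let ?a = "\<lambda>i. (deriv ^^ i) a" and ?f = "\<lambda>i. (cderiv ^^ i) f"
  have "cderiv ((cderiv ^^ n) (\<lambda>u. a u *\<^sub>C f u)) z
      = cderiv (\<lambda>u. \<Sum>i\<le>n. (of_nat (n choose i) * ?a i u) *\<^sub>C ?f (n - i) u) z"
    using Suc by (intro cderiv_cong_open[OF assms(1)]) auto
  also have "\<dots> = (\<Sum>i\<le>n. (of_nat (n choose i) * ?a i z) *\<^sub>C ?f (Suc n - i) z
      + (of_nat (n choose i) * ?a (Suc i) z) *\<^sub>C ?f (n - i) z)"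
  proof (intro cderiv_eq has_cderiv_sum)
    fix i assume "i \<in> {..n}"
    have f: "has_cderiv (?f (n - i)) (?f (Suc n - i) z) z"
      using cdiff_onD[OF cdiff_on_higher_cderiv[OF assms(1,3), of "n - i"] Suc.prems] \<open>i \<in> {..n}\<close>
      by (simp add: Suc_diff_le)
    have "?a i holomorphic_on U" by (rule holomorphic_higher_deriv[OF assms(2,1)])
    then have "(?a i has_field_derivative ?a (Suc i) z) (at z)"
      using holomorphic_derivI[OF _ assms(1) Suc.prems] by simp
    then have "((\<lambda>u. of_nat (n choose i) * ?a i u) has_field_derivative of_nat (n choose i) * ?a (Suc i) z) (at z)"
      by (intro DERIV_cmult)
    from has_cderiv_scale[OF this f]
    show "has_cderiv (\<lambda>u. (of_nat (n choose i) * ?a i u) *\<^sub>C ?f (n - i) u)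
        ((of_nat (n choose i) * ?a i z) *\<^sub>C ?f (Suc n - i) z + (of_nat (n choose i) * ?a (Suc i) z) *\<^sub>C ?f (n - i) z) z" .
  qed
  also have "\<dots> = (\<Sum>i\<le>n. (of_nat (n choose i) * ?a i z) *\<^sub>C ?f (Suc n - i) z)
      + (\<Sum>i\<le>n. (of_nat (n choose i) * ?a (Suc i) z) *\<^sub>C ?f (n - i) z)"
    by (simp add: sum.distrib)
  \<comment> \<open>The added summand i = Suc n has binomial coefficient 0; it gives both sums the
    range that Pascal's identity needs.\<close>
  also have "(\<Sum>i\<le>n. (of_nat (n choose i) * ?a i z) *\<^sub>C ?f (Suc n - i) z)
      = (\<Sum>i\<le>Suc n. (of_nat (n choose i) * ?a i z) *\<^sub>C ?f (Suc n - i) z)"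
by (simp only: sum.atMost_Suc binomial_eq_0[OF lessI] of_nat_0 mult_zero_left scaleC_zero_left add_0_right)
  also have "\<dots> + (\<Sum>i\<le>n. (of_nat (n choose i) * ?a (Suc i) z) *\<^sub>C ?f (n - i) z)
      = (\<Sum>i\<le>Suc n. (of_nat (Suc n choose i) * ?a i z) *\<^sub>C ?f (Suc n - i) z)"
    unfolding sum.atMost_Suc_shift
    by (simp only: sum.distrib distrib_right scaleC_add_left add_ac binomial_Suc_Suc of_nat_add diff_Suc_Suc binomial_n_0)
  finally show ?case by simp
qed simp

section \<open>Jets and Rochberg spaces\<close>

lemma jet_eq_iff:
  "jet n f z = jet n g z \<longleftrightarrow> (\<forall>j<n. (cderiv ^^ j) f z = (cderiv ^^ j) g z)"
proof -
  have "(1 / fact j) *\<^sub>C x = (1 / fact j) *\<^sub>C y \<longleftrightarrow> x = y" for j and x y :: 'a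
    using scaleC_eq_0_iff[of "1 / fact j" "x - y"] by (simp add: scaleC_diff_right)
  then show ?thesis by (auto simp: jet_def fun_eq_iff)
qed

lemma jet_add:
  assumes "open U" "cdiff_on U f" "cdiff_on U g" "z \<in> U"
  shows "jet n (\<lambda>u. f u + g u) z = (\<lambda>j. jet n f z j + jet n g z j)"
  by (simp add: jet_def fun_eq_iff higher_cderiv_add[OF assms] scaleC_add_right)

lemma jet_cmult:
  assumes "open U" "cdiff_on U f" "z \<in> U"
  shows "jet n (\<lambda>u. c *\<^sub>C f u) z = (\<lambda>j. c *\<^sub>C jet n f z j)"
  by (simp add: jet_def fun_eq_iff higher_cderiv_cmult[OF assms] scaleC_scaleC mult.commute)

lemma higher_cderiv_zero [simp]: "(cderiv ^^ n) (\<lambda>u. 0) = (\<lambda>u. 0 :: 'a::complex_banach)"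
proof -
  have "cderiv (\<lambda>u. 0) = (\<lambda>u. 0 :: 'a)" using cderiv_eq[OF has_cderiv_const] by blast
  then show ?thesis by (induction n) auto
qed

lemma jet_zero [simp]: "jet n (\<lambda>u. 0) z = (\<lambda>j. 0)"
  by (simp add: jet_def fun_eq_iff)

text \<open>Every other Leibniz term contains a derivative of f of order below n; only the one with
  all derivatives on f survives.\<close>

lemma higher_cderiv_scale_first:
  assumes "open U" "a holomorphic_on U" "cdiff_on U f" "z \<in> U" "\<And>i. i < n \<Longrightarrow> (cderiv ^^ i) f z = 0"
  shows "(cderiv ^^ n) (\<lambda>u. a u *\<^sub>C f u) z = a z *\<^sub>C (cderiv ^^ n) f z"
proof -
  have "(cderiv ^^ n) (\<lambda>u. a u *\<^sub>C f u) z
      = (\<Sum>i\<in>{0}. (of_nat (n choose i) * (deriv ^^ i) a z) *\<^sub>C (cderiv ^^ (n - i)) f z)"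
    unfolding higher_cderiv_scale[OF assms(1-4)] by (rule sum.mono_neutral_right) (auto simp: assms(5))
  then show ?thesis by simp
qed

text \<open>The Leibniz term i = 0 vanishes with \<open>a z\<close>, and the terms with i \<ge> 2
  contain derivatives of f of order below n. This leaves i = 1 with binomial coefficient n +
  1.\<close>

lemma higher_cderiv_scale_second:
  assumes "open U" "a holomorphic_on U" "cdiff_on U f" "z \<in> U" "\<And>i. i < n \<Longrightarrow> (cderiv ^^ i) f z = 0"
    and "a z = 0"
  shows "(cderiv ^^ Suc n) (\<lambda>u. a u *\<^sub>C f u) z = (of_nat (Suc n) * deriv a z) *\<^sub>C (cderiv ^^ n) f z"
proof -
  have "(cderiv ^^ Suc n) (\<lambda>u. a u *\<^sub>C f u) z
      = (\<Sum>i\<in>{1}. (of_nat (Suc n choose i) * (deriv ^^ i) a z) *\<^sub>C (cderiv ^^ (Suc n - i)) f z)"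
    unfolding higher_cderiv_scale[OF assms(1-4)]
  proof (rule sum.mono_neutral_right)
    show "\<forall>i\<in>{..Suc n} - {1}. (of_nat (Suc n choose i) * (deriv ^^ i) a z) *\<^sub>C (cderiv ^^ (Suc n - i)) f z = 0"
    proof
      fix i assume "i \<in> {..Suc n} - {1}"
      then have "i = 0 \<or> Suc n - i < n" by auto
      then show "(of_nat (Suc n choose i) * (deriv ^^ i) a z) *\<^sub>C (cderiv ^^ (Suc n - i)) f z = 0"
        using assms(5,6) by auto
    qed
  qed auto
  then show ?thesis by simp
qed

lemma rochberg_norm_le:
  assumes "f \<in> carr F" "\<And>g. g \<in> carr F \<Longrightarrow> 0 \<le> vnorm F g"
  shows "vnorm (rochberg F n z) (jet n f z) \<le> vnorm F f"
  unfolding rochberg_def fun_space_def cnspace.simps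
  by (rule cInf_lower) (use assms in \<open>auto intro!: bdd_belowI[of _ 0]\<close>)

text \<open>Since C > 0, the factor passes through the infimum. Operator bounds on a Rochberg space
  can thus be checked on every function that represents the jet.\<close>

lemma le_rochberg_norm:
  assumes "x \<in> carr (rochberg F n z)" "C > 0"
    and "\<And>f. f \<in> carr F \<Longrightarrow> jet n f z = x \<Longrightarrow> b \<le> C * vnorm F f"
  shows "b \<le> C * vnorm (rochberg F n z) x"
proof -
  have "b / C \<le> vnorm (rochberg F n z) x"
    unfolding rochberg_def fun_space_def cnspace.simps
  proof (rule cInf_greatest)
    show "vnorm F ` {f \<in> carr F. jet n f z = x} \<noteq> {}"
      using assms(1) by (auto simp: rochberg_def fun_space_def)
    fix t assume "t \<in> vnorm F ` {f \<in> carr F. jet n f z = x}"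
    then show "b / C \<le> t" using assms(2,3) by (auto simp: field_simps)
  qed
  then show ?thesis using assms(2) by (simp add: field_simps)
qed

lemma carr_rochberg: "carr (rochberg F n z) = (\<lambda>f. jet n f z) ` carr F"
  by (simp add: rochberg_def fun_space_def)

lemma vadd_rochberg: "vadd (rochberg F n z) x y = (\<lambda>j. x j + y j)"
  by (simp add: rochberg_def fun_space_def)

lemma vscale_rochberg: "vscale (rochberg F n z) c x = (\<lambda>j. c *\<^sub>C x j)"
  by (simp add: rochberg_def fun_space_def)

section \<open>The functions in \<open>\<T>\<close>\<close>

locale acceptable_pair =
  fixes U :: "complex set" and F :: "(complex \<Rightarrow> 'a::complex_banach) cnspace"
    and \<psi> :: "complex \<Rightarrow> complex"
  assumes acc: "acceptable U F" and conf: "conformal_equiv \<psi> unit_disc U"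
begin

section \<open>The pointwise operations and the norm of \<open>F\<close>\<close>

lemma open_U: "open U" using acc unfolding acceptable_def by blast

lemma F_fun_space: "F = fun_space (carr F) (vnorm F)" using acc unfolding acceptable_def by blast

lemma vadd_F: "vadd F f g = (\<lambda>u. f u + g u)"
  using fun_cong[OF fun_cong[OF arg_cong[OF F_fun_space, of vadd]]] by (simp add: fun_space_def)

lemma vscale_F: "vscale F c f = (\<lambda>u. c *\<^sub>C f u)"
  using fun_cong[OF fun_cong[OF arg_cong[OF F_fun_space, of vscale]]] by (simp add: fun_space_def)

lemma vzero_F: "vzero F = (\<lambda>u. 0)"
  using arg_cong[OF F_fun_space, of vzero] by (simp add: fun_space_def)

lemma banach_F: "complex_banach_space F" using acc unfolding acceptable_def by blast

lemma F_zero: "(\<lambda>u. 0) \<in> carr F" "vnorm F (\<lambda>u. 0) = 0"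
  using complex_banach_space.zero_closed[OF banach_F]
    complex_banach_space.norm_eq_zero[OF banach_F, of "vzero F"] by (auto simp: vzero_F)

lemma F_norm_nonneg: "f \<in> carr F \<Longrightarrow> 0 \<le> vnorm F f"
  using complex_banach_space.norm_nonneg[OF banach_F] .

lemma F_add:
  assumes "f \<in> carr F" "g \<in> carr F"
  shows "(\<lambda>u. f u + g u) \<in> carr F" "vnorm F (\<lambda>u. f u + g u) \<le> vnorm F f + vnorm F g"
  using complex_banach_space.add_closed[OF banach_F assms]
    complex_banach_space.norm_triangle[OF banach_F assms] by (auto simp: vadd_F)

lemma F_scale:
  assumes "f \<in> carr F"
  shows "(\<lambda>u. c *\<^sub>C f u) \<in> carr F" "vnorm F (\<lambda>u. c *\<^sub>C f u) = cmod c * vnorm F f"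
  using complex_banach_space.scale_closed[OF banach_F assms]
    complex_banach_space.norm_scale[OF banach_F assms] by (auto simp: vscale_F)

lemma F_diff:
  assumes "f \<in> carr F" "g \<in> carr F"
  shows "(\<lambda>u. f u - g u) \<in> carr F" "vnorm F (\<lambda>u. f u - g u) \<le> vnorm F f + vnorm F g"
  using F_add[OF assms(1) F_scale(1)[OF assms(2), of "- 1"]] F_scale(2)[OF assms(2), of "- 1"]
  by (auto simp: scaleC_minus_one)

lemma F_analytic: "f \<in> carr F \<Longrightarrow> analytic_fun U f"
  using acc unfolding acceptable_def by blast

lemma F_cdiff: "f \<in> carr F \<Longrightarrow> cdiff_on U f" and F_outside: "f \<in> carr F \<Longrightarrow> u \<notin> U \<Longrightarrow> f u = 0"
  using F_analytic by (auto simp: analytic_fun_iff)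

lemma F_eqI: "f \<in> carr F \<Longrightarrow> g \<in> carr F \<Longrightarrow> (\<And>u. u \<in> U \<Longrightarrow> f u = g u) \<Longrightarrow> f = g"
  using F_outside by (metis ext)

section \<open>The inverse conformal map, its derivative and the multiplier it defines\<close>

definition \<phi> :: "complex \<Rightarrow> complex" where "\<phi> = the_inv_into unit_disc \<psi>"

lemma \<psi>_hol: "\<psi> holomorphic_on unit_disc" and \<psi>_bij: "bij_betw \<psi> unit_disc U"
  using conf by (auto simp: conformal_equiv_def)

lemma \<psi>_in: "w \<in> unit_disc \<Longrightarrow> \<psi> w \<in> U" using \<psi>_bij bij_betwE by blast

lemma \<phi>_bij: "bij_betw \<phi> U unit_disc" unfolding \<phi>_def by (rule bij_betw_the_inv_into[OF \<psi>_bij])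

lemma \<phi>_in: "u \<in> U \<Longrightarrow> \<phi> u \<in> unit_disc" using \<phi>_bij bij_betwE by blast

lemma \<psi>_\<phi>: "u \<in> U \<Longrightarrow> \<psi> (\<phi> u) = u"
  unfolding \<phi>_def by (rule f_the_inv_into_f_bij_betw[OF \<psi>_bij]) simp

lemma \<phi>_hol: "\<phi> holomorphic_on U"
  and deriv_\<phi>_\<psi>: "w \<in> unit_disc \<Longrightarrow> deriv \<psi> w * deriv \<phi> (\<psi> w) = 1"
proof -
  have inj: "inj_on \<psi> unit_disc" and img: "\<psi> ` unit_disc = U" using \<psi>_bij by (auto simp: bij_betw_def)
  \<comment> \<open>The inverse function theorem yields some holomorphic inverse g. It agrees with
    \<phi> on the open set U and therefore has the same derivative there.\<close>
  obtain g where g: "g holomorphic_on U" "\<And>w. w \<in> unit_disc \<Longrightarrow> deriv \<psi> w * deriv g (\<psi> w) = 1"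
    "\<And>w. w \<in> unit_disc \<Longrightarrow> g (\<psi> w) = w"
    using holomorphic_has_inverse[OF \<psi>_hol open_ball inj] img by metis
  have eq: "g u = \<phi> u" if "u \<in> U" for u using g(3)[OF \<phi>_in[OF that]] by (simp add: \<psi>_\<phi> that)
  show "\<phi> holomorphic_on U" using g(1) eq holomorphic_transform by blast
  show "deriv \<psi> w * deriv \<phi> (\<psi> w) = 1" if "w \<in> unit_disc"
  proof -
    have "\<forall>\<^sub>F u in nhds (\<psi> w). g u = \<phi> u"
      using eventually_nhds_in_open[OF open_U \<psi>_in[OF that]] eq by (auto elim: eventually_mono)
    then have "deriv g (\<psi> w) = deriv \<phi> (\<psi> w)" by (rule deriv_cong_ev) simp
    then show ?thesis using g(2)[OF that] by simp
  qed
qed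

text \<open>By \<open>\<alpha>_deriv_\<psi>\<close> this is the nontrivial diagonal entry of the
  inverse of the matrix L(u).\<close>

definition \<alpha> :: "complex \<Rightarrow> complex" where "\<alpha> = deriv \<phi>"

lemma \<alpha>_hol: "\<alpha> holomorphic_on U"
  unfolding \<alpha>_def using \<phi>_hol open_U holomorphic_deriv by blast

lemma \<alpha>_deriv_\<psi>: "u \<in> U \<Longrightarrow> \<alpha> u * deriv \<psi> (\<phi> u) = 1"
  using deriv_\<phi>_\<psi>[OF \<phi>_in] by (simp add: \<alpha>_def \<psi>_\<phi> mult.commute)

lemma \<alpha>_nz: "u \<in> U \<Longrightarrow> \<alpha> u \<noteq> 0" using \<alpha>_deriv_\<psi> by fastforce

text \<open>The division condition in \<open>acceptable\<close>, read for the conformal map \<phi>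
  itself: multiplication by \<phi> is a bounded operator on F.\<close>

lemma \<phi>_multiplier:
  obtains K where "K > 0" "\<And>f. f \<in> carr F \<Longrightarrow> (\<lambda>u. \<phi> u *\<^sub>C f u) \<in> carr F"
    "\<And>f. f \<in> carr F \<Longrightarrow> vnorm F (\<lambda>u. \<phi> u *\<^sub>C f u) \<le> K * vnorm F f"
proof -
  have "conformal_equiv \<phi> U unit_disc" using \<phi>_hol \<phi>_bij by (simp add: conformal_equiv_def)
  moreover have "\<forall>\<phi>. conformal_equiv \<phi> U unit_disc \<longrightarrow>
        (\<exists>K>0. \<forall>f. analytic_fun U f \<longrightarrow>
           ((\<lambda>u. \<phi> u *\<^sub>C f u) \<in> carr F \<longleftrightarrow> f \<in> carr F) \<and>
           (f \<in> carr F \<longrightarrow>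
              inverse K * vnorm F (\<lambda>u. \<phi> u *\<^sub>C f u) \<le> vnorm F f \<and>
              vnorm F f \<le> K * vnorm F (\<lambda>u. \<phi> u *\<^sub>C f u)))"
    using acc unfolding acceptable_def by (elim conjE)
  ultimately obtain K where K: "K > 0"
      "\<And>f. analytic_fun U f \<Longrightarrow> (\<lambda>u. \<phi> u *\<^sub>C f u) \<in> carr F \<longleftrightarrow> f \<in> carr F"
      "\<And>f. analytic_fun U f \<Longrightarrow> f \<in> carr F \<Longrightarrow> inverse K * vnorm F (\<lambda>u. \<phi> u *\<^sub>C f u) \<le> vnorm F f"
    by blast
  have "vnorm F (\<lambda>u. \<phi> u *\<^sub>C f u) \<le> K * vnorm F f" if "f \<in> carr F" for f
    using K(3)[OF F_analytic[OF that] that] K(1) by (simp add: field_simps)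
  then show ?thesis using that K(1,2) F_analytic by blast
qed

section \<open>Elements of the space of pairs, on U and on the disc\<close>

definition tpair :: "(complex \<Rightarrow> 'a) \<Rightarrow> (complex \<Rightarrow> 'a) \<Rightarrow> complex \<Rightarrow> 'a \<times> 'a" where
  "tpair f h = (\<lambda>u. if u \<in> U then (cderiv f u + \<alpha> u *\<^sub>C h u, f u) else 0)"

text \<open>By the chain rule this is the pair (g1, g) on the disc with g = f \<circ> \<psi> and g1
  - g' = h \<circ> \<psi>; \<open>tpair f h\<close> is its image under \<open>T_map\<close>.\<close>

definition gpair :: "(complex \<Rightarrow> 'a) \<Rightarrow> (complex \<Rightarrow> 'a) \<Rightarrow> complex \<Rightarrow> 'a \<times> 'a" where
  "gpair f h = (\<lambda>w. if w \<in> unit_disc then (deriv \<psi> w *\<^sub>C cderiv f (\<psi> w) + h (\<psi> w), f (\<psi> w)) else 0)"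

lemma has_cderiv_pull:
  assumes "cdiff_on U f" "w \<in> unit_disc"
  shows "has_cderiv (\<lambda>v. f (\<psi> v)) (deriv \<psi> w *\<^sub>C cderiv f (\<psi> w)) w"
  using has_cderiv_compose[OF holomorphic_derivI[OF \<psi>_hol open_ball assms(2)] cdiff_onD[OF assms(1) \<psi>_in[OF assms(2)]]] .

lemma cdiff_on_pull: "cdiff_on U f \<Longrightarrow> cdiff_on unit_disc (\<lambda>v. f (\<psi> v))"
  using has_cderiv_pull unfolding cdiff_on_def[of unit_disc] by blast

text \<open>Makes the inverse in the norm of \<open>G_space\<close> well determined: f is recovered
  on U by composing with \<phi>, and it is 0 elsewhere.\<close>

lemma inj_pull: "inj_on (pull unit_disc \<psi>) (carr F)"
proof
  fix f g assume fg: "f \<in> carr F" "g \<in> carr F" and eq: "pull unit_disc \<psi> f = pull unit_disc \<psi> g"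
  show "f = g"
  proof (rule F_eqI[OF fg])
    fix u assume "u \<in> U"
    then show "f u = g u" using fun_cong[OF eq, of "\<phi> u"] \<phi>_in[of u] by (simp add: pull_def \<psi>_\<phi>)
  qed
qed

lemma carr_G_space: "carr (G_space \<psi> F) = pull unit_disc \<psi> ` carr F"
  by (simp add: G_space_def fun_space_def)

lemma norm_G_space: "f \<in> carr F \<Longrightarrow> vnorm (G_space \<psi> F) (pull unit_disc \<psi> f) = vnorm F f"
  by (simp add: G_space_def fun_space_def the_inv_into_f_f[OF inj_pull])

lemma snd_gpair: "(\<lambda>w. snd (gpair f h w)) = pull unit_disc \<psi> f"
  by (auto simp: gpair_def pull_def)

lemma first_minus_deriv_gpair:
  assumes "f \<in> carr F"
  shows "first_minus_deriv (gpair f h) = pull unit_disc \<psi> h"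
proof
  fix w
  have "cderiv (pull unit_disc \<psi> f) w = deriv \<psi> w *\<^sub>C cderiv f (\<psi> w)" if "w \<in> unit_disc"
  proof -
    have "cderiv (pull unit_disc \<psi> f) w = cderiv (\<lambda>v. f (\<psi> v)) w"
      by (rule cderiv_cong_open[OF open_ball that]) (auto simp: pull_def)
    also have "\<dots> = deriv \<psi> w *\<^sub>C cderiv f (\<psi> w)"
      by (rule cderiv_eq[OF has_cderiv_pull[OF F_cdiff[OF assms] that]])
    finally show ?thesis .
  qed
  then show "first_minus_deriv (gpair f h) w = pull unit_disc \<psi> h w"
    unfolding first_minus_deriv_def snd_gpair by (simp add: gpair_def pull_def)
qed

text \<open>The parameters f and h are read off from the second component and from
  \<open>first_minus_deriv\<close>. Conversely the first component of \<open>gpair f h\<close> is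
  differentiable because f' is, which is where \<open>cdiff_on_cderiv\<close> enters.\<close>

lemma carr_G2: "carr (G2_space \<psi> F) = {gpair f h | f h. f \<in> carr F \<and> h \<in> carr F}"
proof (intro subset_antisym subsetI)
  fix G assume "G \<in> carr (G2_space \<psi> F)"
  then have G: "analytic_fun unit_disc (\<lambda>w. fst (G w))"
    and sn: "(\<lambda>w. snd (G w)) \<in> carr (G_space \<psi> F)" and fm: "first_minus_deriv G \<in> carr (G_space \<psi> F)"
    by (auto simp: G2_space_def fun_space_def)
  obtain f where f: "f \<in> carr F" "(\<lambda>w. snd (G w)) = pull unit_disc \<psi> f"
    using sn by (auto simp: carr_G_space)
  obtain h where h: "h \<in> carr F" "first_minus_deriv G = pull unit_disc \<psi> h"
    using fm by (auto simp: carr_G_space)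
  have "G w = gpair f h w" for w
  proof -
    have s: "snd (G w) = snd (gpair f h w)" using fun_cong[OF f(2), of w] fun_cong[OF snd_gpair[of f h], of w] by simp
    have "first_minus_deriv G w = first_minus_deriv (gpair f h) w"
      by (simp add: h(2) first_minus_deriv_gpair[OF f(1)])
    then have "fst (G w) = fst (gpair f h w)"
    proof (cases "w \<in> unit_disc")
      case True
      with \<open>first_minus_deriv G w = _\<close> show ?thesis unfolding first_minus_deriv_def f(2) snd_gpair by simp
    next
      \<comment> \<open>Outside the disc \<open>first_minus_deriv\<close> carries no information;
        there the first component vanishes by the convention in \<open>analytic_fun\<close>.\<close>
      case False
      then show ?thesis using G by (simp add: analytic_fun_iff gpair_def)
    qed
    then show ?thesis using s by (simp add: prod_eq_iff)
  qed
  then have "G = gpair f h" ..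
  then show "G \<in> {gpair f h | f h. f \<in> carr F \<and> h \<in> carr F}" using f(1) h(1) by blast
next
  fix G assume "G \<in> {gpair f h | f h. f \<in> carr F \<and> h \<in> carr F}"
  then obtain f h where fh: "f \<in> carr F" "h \<in> carr F" and G: "G = gpair f h" by blast
  have "cdiff_on unit_disc (\<lambda>w. deriv \<psi> w *\<^sub>C cderiv f (\<psi> w) + h (\<psi> w))"
    using fh by (intro cdiff_on_add cdiff_on_scale cdiff_on_pull F_cdiff open_ball
        holomorphic_deriv[OF \<psi>_hol] cdiff_on_cderiv[OF open_U])
  then have "cdiff_on unit_disc (\<lambda>w. fst (G w))"
    by (rule cdiff_on_cong[OF open_ball, rotated]) (simp add: G gpair_def)
  moreover have "cdiff_on unit_disc (\<lambda>w. snd (G w))"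
    by (rule cdiff_on_cong[OF open_ball _ cdiff_on_pull[OF F_cdiff[OF fh(1)]]]) (simp add: G gpair_def)
  ultimately show "G \<in> carr (G2_space \<psi> F)"
    using fh first_minus_deriv_gpair[OF fh(1), of h] snd_gpair[of f h]
    by (auto simp: G G2_space_def fun_space_def carr_G_space analytic_fun_iff gpair_def)
qed

text \<open>The inverse of L(u) multiplies the first entry by \<open>\<alpha> u\<close>, which turns
  \<psi>' f' + h into f' + \<alpha> h.\<close>

lemma T_map_gpair: "T_map U \<psi> (gpair f h) = tpair f h"
proof
  fix u
  show "T_map U \<psi> (gpair f h) u = tpair f h u"
  proof (cases "u \<in> U")
    case True
    define d where "d = deriv \<psi> (\<phi> u)"
    have ad: "\<alpha> u * d = 1" "d \<noteq> 0" using \<alpha>_deriv_\<psi>[OF True] by (auto simp: d_def)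
    have L: "L_map \<psi> u = (\<lambda>(x1, x0). (d *\<^sub>C x1, x0 :: 'a))" by (simp add: L_map_def d_def \<phi>_def)
    \<comment> \<open>Injectivity allows \<open>inv\<close> to be evaluated by exhibiting a
      preimage, here \<open>tpair f h u\<close>.\<close>
    have inj: "inj (L_map \<psi> u :: 'a \<times> 'a \<Rightarrow> _)"
    proof (rule injI)
      fix p q :: "'a \<times> 'a" assume "L_map \<psi> u p = L_map \<psi> u q"
      then have "d *\<^sub>C (fst p - fst q) = 0" "snd p = snd q"
        by (simp_all add: L scaleC_diff_right split: prod.splits)
      then show "p = q" using ad(2) by (simp add: scaleC_eq_0_iff prod_eq_iff)
    qed
    have "inv (L_map \<psi> u) (gpair f h (\<phi> u)) = tpair f h u"
    proof (rule inv_f_eq[OF inj])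
      show "L_map \<psi> u (tpair f h u) = gpair f h (\<phi> u)"
        using ad(1) \<phi>_in[OF True]
        by (simp add: L tpair_def gpair_def True \<psi>_\<phi> scaleC_add_right scaleC_scaleC scaleC_one mult.commute
            d_def[symmetric])
    qed
    then show ?thesis using True by (simp add: T_map_def \<phi>_def)
  qed (simp add: T_map_def tpair_def)
qed

text \<open>The second component determines f; then h follows because \<alpha> has no zero in
  U.\<close>

lemma tpair_inj:
  assumes "f \<in> carr F" "h \<in> carr F" "f' \<in> carr F" "h' \<in> carr F" "tpair f h = tpair f' h'"
  shows "f = f'" "h = h'"
proof -
  have p: "cderiv f u + \<alpha> u *\<^sub>C h u = cderiv f' u + \<alpha> u *\<^sub>C h' u" "f u = f' u" if "u \<in> U" for u
    using fun_cong[OF assms(5), of u] that by (auto simp: tpair_def)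
  show f: "f = f'" using p(2) by (intro F_eqI assms) auto
  show "h = h'"
  proof (intro F_eqI assms)
    fix u assume "u \<in> U"
    then have "\<alpha> u *\<^sub>C (h u - h' u) = 0" using p(1)[of u] f by (simp add: scaleC_diff_right)
    then show "h u = h' u" using \<alpha>_nz[OF \<open>u \<in> U\<close>] by (simp add: scaleC_eq_0_iff)
  qed
qed

lemma inj_T_map: "inj_on (T_map U \<psi>) (carr (G2_space \<psi> F))"
proof (rule inj_onI)
  fix G G' assume "G \<in> carr (G2_space \<psi> F)" "G' \<in> carr (G2_space \<psi> F)" and eq: "T_map U \<psi> G = T_map U \<psi> G'"
  then obtain f h f' h' where fh: "f \<in> carr F" "h \<in> carr F" "f' \<in> carr F" "h' \<in> carr F"
    and G: "G = gpair f h" "G' = gpair f' h'"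
    unfolding carr_G2 by blast
  show "G = G'" using tpair_inj[OF fh] eq unfolding G T_map_gpair by simp
qed

lemma carr_T: "carr (T_space U \<psi> F) = {tpair f h | f h. f \<in> carr F \<and> h \<in> carr F}"
  unfolding T_space_def fun_space_def cnspace.simps carr_G2 by (force simp: T_map_gpair)

lemma norm_T:
  assumes "f \<in> carr F" "h \<in> carr F"
  shows "vnorm (T_space U \<psi> F) (tpair f h) = vnorm F h + vnorm F f"
proof -
  have "gpair f h \<in> carr (G2_space \<psi> F)" using assms by (auto simp: carr_G2)
  then have "the_inv_into (carr (G2_space \<psi> F)) (T_map U \<psi>) (tpair f h) = gpair f h"
    using the_inv_into_f_f[OF inj_T_map] by (simp add: T_map_gpair[symmetric])
  then have "vnorm (T_space U \<psi> F) (tpair f h) = vnorm (G2_space \<psi> F) (gpair f h)"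
    by (simp add: T_space_def fun_space_def)
  also have "\<dots> = vnorm F h + vnorm F f"
    using norm_G_space assms
    by (simp add: G2_space_def fun_space_def[of "Collect _"] first_minus_deriv_gpair snd_gpair)
  finally show ?thesis .
qed

lemma norm_T_nonneg: "t \<in> carr (T_space U \<psi> F) \<Longrightarrow> 0 \<le> vnorm (T_space U \<psi> F) t"
  by (auto simp: carr_T norm_T F_norm_nonneg)

lemma cdiff_on_tpair:
  assumes "f \<in> carr F" "h \<in> carr F"
  shows "cdiff_on U (tpair f h)"
proof -
  have "cdiff_on U (\<lambda>u. cderiv f u + \<alpha> u *\<^sub>C h u)"
    using assms by (intro cdiff_on_add cdiff_on_scale cdiff_on_cderiv open_U \<alpha>_hol F_cdiff)
  then have "cdiff_on U (\<lambda>u. (cderiv f u + \<alpha> u *\<^sub>C h u, f u))"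
    using F_cdiff[OF assms(1)] has_cderiv_Pair unfolding cdiff_on_def by blast
  then show ?thesis by (rule cdiff_on_cong[OF open_U, rotated]) (simp add: tpair_def)
qed

lemma tpair_add:
  assumes "f \<in> carr F" "f' \<in> carr F"
  shows "tpair (\<lambda>u. f u + f' u) (\<lambda>u. h u + h' u) = (\<lambda>u. tpair f h u + tpair f' h' u)"
proof
  fix u
  have "cderiv (\<lambda>u. f u + f' u) u = cderiv f u + cderiv f' u" if "u \<in> U"
    using assms that by (intro cderiv_eq has_cderiv_add cdiff_onD[of U] F_cdiff)
  then show "tpair (\<lambda>u. f u + f' u) (\<lambda>u. h u + h' u) u = tpair f h u + tpair f' h' u"
    by (simp add: tpair_def scaleC_add_right)
qed

lemma tpair_scale:
  assumes "f \<in> carr F"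
  shows "tpair (\<lambda>u. c *\<^sub>C f u) (\<lambda>u. c *\<^sub>C h u) = (\<lambda>u. c *\<^sub>C tpair f h u)"
proof
  fix u
  have "cderiv (\<lambda>u. c *\<^sub>C f u) u = c *\<^sub>C cderiv f u" if "u \<in> U"
    using assms that by (intro cderiv_eq has_cderiv_cmult cdiff_onD[of U] F_cdiff)
  then show "tpair (\<lambda>u. c *\<^sub>C f u) (\<lambda>u. c *\<^sub>C h u) u = c *\<^sub>C tpair f h u"
    by (simp add: tpair_def scaleC_add_right scaleC_prod_def scaleC_scaleC mult.commute zero_prod_def)
qed

lemma higher_cderiv_tpair:
  assumes "f \<in> carr F" "h \<in> carr F" "z \<in> U"
  shows "(cderiv ^^ j) (tpair f h) z
    = ((cderiv ^^ Suc j) f z + (cderiv ^^ j) (\<lambda>u. \<alpha> u *\<^sub>C h u) z, (cderiv ^^ j) f z)"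
proof -
  have c: "cdiff_on U (cderiv f)" "cdiff_on U (\<lambda>u. \<alpha> u *\<^sub>C h u)"
    using assms by (auto intro: cdiff_on_scale cdiff_on_cderiv open_U \<alpha>_hol F_cdiff)
  have "(cderiv ^^ j) (tpair f h) z = (cderiv ^^ j) (\<lambda>u. (cderiv f u + \<alpha> u *\<^sub>C h u, f u)) z"
    by (rule higher_cderiv_cong[OF open_U _ assms(3)]) (simp add: tpair_def)
  also have "\<dots> = ((cderiv ^^ j) (\<lambda>u. cderiv f u + \<alpha> u *\<^sub>C h u) z, (cderiv ^^ j) f z)"
    by (rule higher_cderiv_Pair[OF open_U cdiff_on_add[OF c] F_cdiff[OF assms(1)] assms(3)])
  also have "(cderiv ^^ j) (\<lambda>u. cderiv f u + \<alpha> u *\<^sub>C h u) z = (cderiv ^^ j) (cderiv f) z + (cderiv ^^ j) (\<lambda>u. \<alpha> u *\<^sub>C h u) z"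
    by (rule higher_cderiv_add[OF open_U c assms(3)])
  finally show ?thesis by (simp add: funpow_swap1)
qed

end

section \<open>Jets of functions in \<open>\<T>\<close>\<close>

locale acceptable_point = acceptable_pair U F \<psi>
  for U :: "complex set" and F :: "(complex \<Rightarrow> 'a::complex_banach) cnspace" and \<psi> +
  fixes z :: complex and m :: nat
  assumes m_ge_1: "m \<ge> 1" and z_in: "z \<in> U"
begin

definition J :: "(complex \<Rightarrow> 'a) \<Rightarrow> (complex \<Rightarrow> 'a) \<Rightarrow> nat \<Rightarrow> 'a \<times> 'a" where
  "J f h = jet m (tpair f h) z"

abbreviation M :: "(nat \<Rightarrow> 'a \<times> 'a) cnspace" where "M \<equiv> F2_space U \<psi> F m z"

text \<open>\<open>m - Suc 0\<close> is the form into which simplification brings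
  \<open>m - 1\<close>. For m = 1 all jets are empty, and this is the zero space.\<close>

abbreviation R :: "(nat \<Rightarrow> 'a) cnspace" where "R \<equiv> rochberg F (m - Suc 0) z"

definition j0 :: "(complex \<Rightarrow> 'a) \<Rightarrow> nat \<Rightarrow> 'a" where "j0 h = jet (m - Suc 0) h z"

text \<open>The m-th derivative of (\<phi> - \<phi> z) h at z contains m \<alpha>(z) times the
  derivative of h of order m - 1; the coefficient -1/m is there to turn this factor into
  -\<alpha>(z).\<close>

definition B :: "(complex \<Rightarrow> 'a) \<Rightarrow> complex \<Rightarrow> 'a" where
  "B h = (\<lambda>u. (- 1 / of_nat m * (\<phi> u - \<phi> z)) *\<^sub>C h u)"

lemma carr_R: "carr R = j0 ` carr F" by (simp add: carr_rochberg j0_def)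

lemma carr_M: "carr M = {J f h | f h. f \<in> carr F \<and> h \<in> carr F}"
  unfolding F2_space_def carr_rochberg carr_T J_def by blast

lemma vadd_M: "vadd M x y = (\<lambda>j. x j + y j)" by (simp add: F2_space_def vadd_rochberg)

lemma vscale_M: "vscale M c x = (\<lambda>j. c *\<^sub>C x j)" by (simp add: F2_space_def vscale_rochberg)

lemma norm_M_le:
  assumes "f \<in> carr F" "h \<in> carr F"
  shows "vnorm M (J f h) \<le> vnorm F h + vnorm F f"
proof -
  have "vnorm M (J f h) \<le> vnorm (T_space U \<psi> F) (tpair f h)"
    unfolding F2_space_def J_def by (rule rochberg_norm_le) (use assms in \<open>auto simp: carr_T norm_T_nonneg\<close>)
  then show ?thesis by (simp add: norm_T assms)
qed

lemma le_norm_M: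
  assumes "y \<in> carr M" "C > 0"
    and "\<And>f h. f \<in> carr F \<Longrightarrow> h \<in> carr F \<Longrightarrow> J f h = y \<Longrightarrow> b \<le> C * (vnorm F h + vnorm F f)"
  shows "b \<le> C * vnorm M y"
  unfolding F2_space_def
proof (rule le_rochberg_norm)
  show "y \<in> carr (rochberg (T_space U \<psi> F) m z)" using assms(1) by (simp add: F2_space_def)
  fix t assume "t \<in> carr (T_space U \<psi> F)" "jet m t z = y"
  then obtain f h where "f \<in> carr F" "h \<in> carr F" "t = tpair f h" "J f h = y"
    by (auto simp: carr_T J_def)
  then show "b \<le> C * vnorm (T_space U \<psi> F) t" using assms(3) by (simp add: norm_T)
qed fact

lemma norm_M_nonneg: "y \<in> carr M \<Longrightarrow> 0 \<le> vnorm M y"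
  using le_norm_M[of y 1 0] F_norm_nonneg by fastforce

lemma norm_R_le: "h \<in> carr F \<Longrightarrow> vnorm R (j0 h) \<le> vnorm F h"
  unfolding j0_def by (rule rochberg_norm_le) (auto intro: F_norm_nonneg)

lemma J_add:
  assumes "f \<in> carr F" "h \<in> carr F" "f' \<in> carr F" "h' \<in> carr F"
  shows "J (\<lambda>u. f u + f' u) (\<lambda>u. h u + h' u) = (\<lambda>j. J f h j + J f' h' j)"
  unfolding J_def tpair_add[OF assms(1,3)]
  by (rule jet_add[OF open_U cdiff_on_tpair cdiff_on_tpair z_in]) (use assms in auto)

lemma J_scale:
  assumes "f \<in> carr F" "h \<in> carr F"
  shows "J (\<lambda>u. c *\<^sub>C f u) (\<lambda>u. c *\<^sub>C h u) = (\<lambda>j. c *\<^sub>C J f h j)"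
  unfolding J_def tpair_scale[OF assms(1)]
  by (rule jet_cmult[OF open_U cdiff_on_tpair z_in]) (use assms in auto)

lemma J_diff:
  assumes "f \<in> carr F" "h \<in> carr F" "f' \<in> carr F" "h' \<in> carr F"
  shows "J (\<lambda>u. f u - f' u) (\<lambda>u. h u - h' u) = (\<lambda>j. J f h j - J f' h' j)"
  using J_add[OF assms(1,2) F_scale(1)[OF assms(3), of "- 1"] F_scale(1)[OF assms(4), of "- 1"]]
    J_scale[OF assms(3,4), of "- 1"]
  by (simp add: scaleC_minus_one)

lemma j0_add: "f \<in> carr F \<Longrightarrow> g \<in> carr F \<Longrightarrow> j0 (\<lambda>u. f u + g u) = (\<lambda>j. j0 f j + j0 g j)"
  unfolding j0_def by (rule jet_add[OF open_U F_cdiff F_cdiff z_in])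

lemma j0_scale: "f \<in> carr F \<Longrightarrow> j0 (\<lambda>u. c *\<^sub>C f u) = (\<lambda>j. c *\<^sub>C j0 f j)"
  unfolding j0_def by (rule jet_cmult[OF open_U F_cdiff z_in])

lemma j0_diff: "f \<in> carr F \<Longrightarrow> g \<in> carr F \<Longrightarrow> j0 (\<lambda>u. f u - g u) = (\<lambda>j. j0 f j - j0 g j)"
  using j0_add[OF _ F_scale(1), of f g "- 1"] j0_scale[of g "- 1"] by (simp add: scaleC_minus_one)

lemma J_eq_0_iff:
  assumes "f \<in> carr F" "h \<in> carr F"
  shows "J f h = (\<lambda>j. 0) \<longleftrightarrow> (\<forall>j<m. (cderiv ^^ Suc j) f z + (cderiv ^^ j) (\<lambda>u. \<alpha> u *\<^sub>C h u) z = 0 \<and>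
    (cderiv ^^ j) f z = 0)"
proof -
  have "J f h = (\<lambda>j. 0) \<longleftrightarrow> (\<forall>j<m. (cderiv ^^ j) (tpair f h) z = 0)"
    using jet_eq_iff[of m "tpair f h" z "\<lambda>u. 0"] by (simp add: J_def)
  then show ?thesis by (simp add: higher_cderiv_tpair assms z_in zero_prod_def)
qed

lemma j0_eq_0_iff: "j0 h = (\<lambda>j. 0) \<longleftrightarrow> (\<forall>j<m - 1. (cderiv ^^ j) h z = 0)"
  using jet_eq_iff[of "m - 1" h z "\<lambda>u. 0"] by (simp add: j0_def)

text \<open>The factor j + 1 turns the Taylor coefficients of f into those of f', so row j is the
  j-th coefficient of (f', f), the pair with h = 0.\<close>

lemma E2_jet:
  assumes "f \<in> carr F"
  shows "E2_op m (jet (m + 1) f z) = J f (\<lambda>u. 0)"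
proof
  fix j
  have "of_nat (j + 1) * (1 / fact (j + 1)) = (1 / fact j :: complex)"
    by (simp add: fact_Suc field_simps del: of_nat_Suc)
  then have "of_nat (j + 1) *\<^sub>C (1 / fact (j + 1)) *\<^sub>C x = (1 / fact j) *\<^sub>C x" for x :: 'a
    unfolding scaleC_scaleC by simp
  then show "E2_op m (jet (m + 1) f z) j = J f (\<lambda>u. 0) j"
    unfolding E2_op_def J_def jet_def
    using higher_cderiv_tpair[OF assms F_zero(1) z_in, of j]
    by (simp add: scaleC_prod_def zero_prod_def)
qed

text \<open>The second column kills the derivatives of f at z of order below m, and then the first
  column kills those of \<alpha> h. One order is lost, since the m-th derivative of f is not
  controlled.\<close>

lemma J_eq_0_imp_j0_eq_0:
  assumes "f \<in> carr F" "h \<in> carr F" "J f h = (\<lambda>j. 0)"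
  shows "j0 h = (\<lambda>j. 0)"
proof -
  \<comment> \<open>The reciprocal of \<alpha> on U, used to pass from \<alpha> h back to h.\<close>
  let ?b = "\<lambda>u. deriv \<psi> (\<phi> u)"
  have J0: "(cderiv ^^ Suc j) f z + (cderiv ^^ j) (\<lambda>u. \<alpha> u *\<^sub>C h u) z = 0" "(cderiv ^^ j) f z = 0" if "j < m" for j
    using assms(3) that unfolding J_eq_0_iff[OF assms(1,2)] by auto
  have \<alpha>h: "(cderiv ^^ j) (\<lambda>u. \<alpha> u *\<^sub>C h u) z = 0" if "j < m - 1" for j
    using J0(1)[of j] J0(2)[of "Suc j"] that by simp
  have "deriv \<psi> holomorphic_on unit_disc" by (rule holomorphic_deriv[OF \<psi>_hol open_ball])
  then have b: "?b holomorphic_on U"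
    using holomorphic_on_compose_gen[OF \<phi>_hol, of "deriv \<psi>" unit_disc] \<phi>_in by (auto simp: comp_def image_subset_iff)
  have "(cderiv ^^ j) h z = 0" if "j < m - 1" for j
  proof -
    have "(cderiv ^^ j) h z = (cderiv ^^ j) (\<lambda>u. ?b u *\<^sub>C \<alpha> u *\<^sub>C h u) z"
      by (rule higher_cderiv_cong[OF open_U _ z_in])
        (simp add: scaleC_scaleC mult.commute \<alpha>_deriv_\<psi> scaleC_one)
    also have "\<dots> = ?b z *\<^sub>C (cderiv ^^ j) (\<lambda>u. \<alpha> u *\<^sub>C h u) z"
      using \<alpha>h that
      by (intro higher_cderiv_scale_first[OF open_U b cdiff_on_scale[OF open_U \<alpha>_hol F_cdiff] z_in] assms) auto
    finally show ?thesis using \<alpha>h[OF that] by simp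
  qed
  then show ?thesis by (simp add: j0_eq_0_iff)
qed

section \<open>The bounded multiplication operator \<open>B\<close> and the cancellation in
  \<open>J (B h) h\<close>\<close>

lemma B_in:
  obtains K where "K > 0" "\<And>h. h \<in> carr F \<Longrightarrow> B h \<in> carr F" "\<And>h. h \<in> carr F \<Longrightarrow> vnorm F (B h) \<le> K * vnorm F h"
proof -
  obtain K where K: "K > 0" "\<And>f. f \<in> carr F \<Longrightarrow> (\<lambda>u. \<phi> u *\<^sub>C f u) \<in> carr F"
    "\<And>f. f \<in> carr F \<Longrightarrow> vnorm F (\<lambda>u. \<phi> u *\<^sub>C f u) \<le> K * vnorm F f"
    using \<phi>_multiplier by blast
  define c :: complex where "c = - 1 / of_nat m"
  have Beq: "B h = (\<lambda>u. c *\<^sub>C (\<phi> u *\<^sub>C h u - \<phi> z *\<^sub>C h u))" for h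
    by (simp add: B_def c_def scaleC_diff_left[symmetric] scaleC_scaleC)
  \<comment> \<open>The summand 1 makes the constant visibly positive.\<close>
  have "B h \<in> carr F \<and> vnorm F (B h) \<le> (cmod c * (K + cmod (\<phi> z)) + 1) * vnorm F h" if h: "h \<in> carr F" for h
  proof -
    note d = F_diff[OF K(2)[OF h] F_scale(1)[OF h, of "\<phi> z"]]
    have "vnorm F (B h) = cmod c * vnorm F (\<lambda>u. \<phi> u *\<^sub>C h u - \<phi> z *\<^sub>C h u)"
      unfolding Beq by (rule F_scale(2)[OF d(1)])
    also have "\<dots> \<le> cmod c * (K * vnorm F h + cmod (\<phi> z) * vnorm F h)"
      using d(2) K(3)[OF h] F_scale(2)[OF h, of "\<phi> z"] by (intro mult_left_mono) auto
    finally have "vnorm F (B h) \<le> (cmod c * (K + cmod (\<phi> z)) + 1) * vnorm F h"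
      using F_norm_nonneg[OF h] by (simp add: algebra_simps)
    moreover have "B h \<in> carr F" unfolding Beq by (rule F_scale(1)[OF d(1)])
    ultimately show ?thesis by blast
  qed
  then show ?thesis using that[of "cmod c * (K + cmod (\<phi> z)) + 1"] K(1) by (simp add: add_nonneg_pos)
qed

lemma B_carr: "h \<in> carr F \<Longrightarrow> B h \<in> carr F"
  using B_in by metis

lemma B_add: "B (\<lambda>u. h u + k u) = (\<lambda>u. B h u + B k u)" by (simp add: B_def scaleC_add_right)

lemma B_diff: "B (\<lambda>u. h u - k u) = (\<lambda>u. B h u - B k u)" by (simp add: B_def scaleC_diff_right)

lemma B_scale: "B (\<lambda>u. c *\<^sub>C h u) = (\<lambda>u. c *\<^sub>C B h u)" by (simp add: B_def scaleC_scaleC mult_ac)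

lemma B_zero: "B (\<lambda>u. 0) = (\<lambda>u. 0)" by (simp add: B_def)

text \<open>Here h vanishes at z to order m - 1, hence B h to order m, and the m-th derivative of B
  h cancels the only derivative of \<alpha> h of order below m that can be nonzero.\<close>

lemma J_B_eq_0:
  assumes h: "h \<in> carr F" and "j0 h = (\<lambda>j. 0)"
  shows "J (B h) h = (\<lambda>j. 0)"
proof -
  define n where "n = m - 1"
  have m: "m = Suc n" using m_ge_1 by (simp add: n_def)
  let ?b = "\<lambda>u. - 1 / of_nat m * (\<phi> u - \<phi> z)"
  have h0: "(cderiv ^^ i) h z = 0" if "i < n" for i using assms(2) that by (simp add: j0_eq_0_iff n_def)
  have b: "?b holomorphic_on U" by (intro holomorphic_intros \<phi>_hol)
  have "(\<phi> has_field_derivative \<alpha> z) (at z)"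
    unfolding \<alpha>_def using holomorphic_derivI[OF \<phi>_hol open_U z_in] .
  then have "(?b has_field_derivative - 1 / of_nat m * (\<alpha> z - 0)) (at z)"
    by (intro DERIV_cmult DERIV_diff DERIV_const)
  then have b': "deriv ?b z = - 1 / of_nat m * \<alpha> z" by (simp add: DERIV_imp_deriv)
  \<comment> \<open>The multiplier vanishes at z, which gains one order of vanishing over h.\<close>
  have B0: "(cderiv ^^ j) (B h) z = 0" if "j \<le> n" for j
    unfolding B_def using higher_cderiv_scale_first[OF open_U b F_cdiff[OF h] z_in, of j] h0 that by simp
  have "(cderiv ^^ Suc n) (B h) z = (of_nat (Suc n) * deriv ?b z) *\<^sub>C (cderiv ^^ n) h z"
    unfolding B_def by (rule higher_cderiv_scale_second[OF open_U b F_cdiff[OF h] z_in h0]) auto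
  moreover have "of_nat (Suc n) * deriv ?b z = - \<alpha> z"
    unfolding b' by (simp add: m del: of_nat_Suc)
  ultimately have B1: "(cderiv ^^ Suc n) (B h) z = - (\<alpha> z *\<^sub>C (cderiv ^^ n) h z)"
    by (simp add: scaleC_minus_left)
  have a0: "(cderiv ^^ j) (\<lambda>u. \<alpha> u *\<^sub>C h u) z = \<alpha> z *\<^sub>C (cderiv ^^ j) h z" if "j \<le> n" for j
    by (rule higher_cderiv_scale_first[OF open_U \<alpha>_hol F_cdiff[OF h] z_in]) (use h0 that in auto)
  have "(cderiv ^^ Suc j) (B h) z + (cderiv ^^ j) (\<lambda>u. \<alpha> u *\<^sub>C h u) z = 0 \<and> (cderiv ^^ j) (B h) z = 0"
    if "j < m" for j
  \<comment> \<open>Only the top row j = n involves the derivative of order m; the cancellation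
    \<open>B1\<close> takes place there.\<close>
  proof (cases "j = n")
    case True
    then show ?thesis using B0[of n] B1 a0[of n] by simp
  next
    case False
    then have "j < n" using that m by simp
    then show ?thesis using B0[of j] B0[of "Suc j"] a0[of j] h0[of j] by simp
  qed
  then show ?thesis using J_eq_0_iff[OF B_carr[OF h] h] by blast
qed

text \<open>Well-definedness of J f h \<mapsto> j0 h, reduced by linearity to the case of the zero
  jet.\<close>

lemma J_eq_imp_j0_eq:
  assumes "f \<in> carr F" "h \<in> carr F" "f' \<in> carr F" "h' \<in> carr F" "J f h = J f' h'"
  shows "j0 h = j0 h'"
proof -
  have "J (\<lambda>u. f u - f' u) (\<lambda>u. h u - h' u) = (\<lambda>j. 0)" using J_diff[OF assms(1-4)] assms(5) by simp
  then have "j0 (\<lambda>u. h u - h' u) = (\<lambda>j. 0)" using J_eq_0_imp_j0_eq_0 F_diff(1) assms(1-4) by blast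
  then show ?thesis using assms by (simp add: j0_diff fun_eq_iff)
qed

text \<open>With k = h' - h, subtracting the zero jet \<open>J (B k) k\<close> removes k from the
  second argument. Jets with the same image under J f h \<mapsto> j0 h thus differ by an element of
  the range of \<open>E2_op m\<close>.\<close>

lemma J_same_j0:
  assumes "f \<in> carr F" "h \<in> carr F" "f' \<in> carr F" "h' \<in> carr F" "j0 h' = j0 h"
  shows "J f' h' = (\<lambda>j. J f h j + J (\<lambda>u. f' u - f u - B (\<lambda>u. h' u - h u) u) (\<lambda>u. 0) j)"
proof -
  define k where "k = (\<lambda>u. h' u - h u)"
  have k: "k \<in> carr F" unfolding k_def using assms F_diff(1) by blast
  have "j0 k = (\<lambda>j. 0)" unfolding k_def using assms by (simp add: j0_diff)
  then have 0: "J (B k) k = (\<lambda>j. 0)" by (rule J_B_eq_0[OF k])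
  have d: "(\<lambda>u. f' u - f u) \<in> carr F" using assms F_diff(1) by blast
  have "J (\<lambda>u. (f' u - f u) - B k u) (\<lambda>u. k u - k u) = (\<lambda>j. J (\<lambda>u. f' u - f u) k j - J (B k) k j)"
    by (rule J_diff[OF d k B_carr[OF k] k])
  also have "\<dots> = (\<lambda>j. J f' h' j - J f h j)"
    using J_diff[OF assms(3,4,1,2)] 0 by (simp add: k_def)
  finally show ?thesis by (simp add: k_def fun_eq_iff)
qed

section \<open>The range of \<open>E2_op m\<close> and the projection onto it\<close>

lemma E2_range: "E2_op m ` carr (rochberg F (m + 1) z) = {J g (\<lambda>u. 0) | g. g \<in> carr F}"
  unfolding carr_rochberg image_image using E2_jet by (auto simp: image_def)

lemma bounded_E2: "bounded_operator (rochberg F (m + 1) z) M (E2_op m)"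
  unfolding bounded_operator_def
proof (intro conjI ballI allI exI funcsetI)
  fix x assume x: "x \<in> carr (rochberg F (m + 1) z)"
  show "E2_op m x \<in> carr M" using x F_zero(1) E2_jet by (auto simp: carr_rochberg carr_M)
  fix c
  show "E2_op m (vscale (rochberg F (m + 1) z) c x) = vscale M c (E2_op m x)"
    by (auto simp: vscale_rochberg vscale_M E2_op_def fun_eq_iff scaleC_prod_def scaleC_scaleC mult.commute)
  have "vnorm M (E2_op m x) \<le> 1 * vnorm (rochberg F (m + 1) z) x"
  proof (rule le_rochberg_norm[OF x])
    fix f assume "f \<in> carr F" "jet (m + 1) f z = x"
    then show "vnorm M (E2_op m x) \<le> 1 * vnorm F f"
      using norm_M_le[OF _ F_zero(1), of f] E2_jet[of f] F_zero(2) by auto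
  qed simp
  then show "vnorm M (E2_op m x) \<le> 1 * vnorm (rochberg F (m + 1) z) x" .
next
  fix x y
  show "E2_op m (vadd (rochberg F (m + 1) z) x y) = vadd M (E2_op m x) (E2_op m y)"
    by (auto simp: vadd_rochberg vadd_M E2_op_def fun_eq_iff scaleC_add_right)
qed

lemma complemented_E2: "complemented_in {J g (\<lambda>u. 0) | g. g \<in> carr F} M"
proof -
  \<comment> \<open>Any representation y = J f h may be chosen; the next fact shows that the value
    does not depend on it.\<close>
  define P where "P y = (SOME p. \<exists>f h. f \<in> carr F \<and> h \<in> carr F \<and> J f h = y \<and> p = J (\<lambda>u. f u - B h u) (\<lambda>u. 0))" for y
  have P: "P (J f h) = J (\<lambda>u. f u - B h u) (\<lambda>u. 0)" if fh: "f \<in> carr F" "h \<in> carr F" for f h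
  proof -
    have "\<exists>p f' h'. f' \<in> carr F \<and> h' \<in> carr F \<and> J f' h' = J f h \<and> p = J (\<lambda>u. f' u - B h' u) (\<lambda>u. 0)"
      using fh by blast
    from someI_ex[OF this] obtain f' h' where fh': "f' \<in> carr F" "h' \<in> carr F" "J f' h' = J f h"
      and p: "P (J f h) = J (\<lambda>u. f' u - B h' u) (\<lambda>u. 0)" unfolding P_def by blast
    note d = F_diff(1)[OF fh(1) B_carr[OF fh(2)]] F_diff(1)[OF fh'(1) B_carr[OF fh'(2)]]
    \<comment> \<open>Both representations have the same \<open>j0\<close>, so
      \<open>J_same_j0\<close> writes the difference of the equal jets as this one.\<close>
    have "J (\<lambda>u. f' u - f u - B (\<lambda>u. h' u - h u) u) (\<lambda>u. 0) = (\<lambda>j. 0)"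
      using J_same_j0[OF fh fh'(1,2) J_eq_imp_j0_eq[OF fh'(1,2) fh fh'(3)]] fh'(3) by (simp add: fun_eq_iff)
    moreover have "(\<lambda>u. f' u - f u - B (\<lambda>u. h' u - h u) u) = (\<lambda>u. (f' u - B h' u) - (f u - B h u))"
      by (simp add: B_diff algebra_simps)
    ultimately show ?thesis using J_diff[OF d(2) F_zero(1) d(1) F_zero(1)] p by (simp add: fun_eq_iff)
  qed
  obtain K where K: "K > 0" "\<And>h. h \<in> carr F \<Longrightarrow> vnorm F (B h) \<le> K * vnorm F h"
    using B_in by metis
  have "bounded_operator M M P"
    unfolding bounded_operator_def
  proof (intro conjI ballI allI exI funcsetI)
    fix x assume x: "x \<in> carr M"
    then obtain f h where fh: "f \<in> carr F" "h \<in> carr F" and xJ: "x = J f h" by (auto simp: carr_M)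
    show "P x \<in> carr M" unfolding xJ P[OF fh] using F_diff(1)[OF fh(1) B_carr[OF fh(2)]] F_zero(1) by (auto simp: carr_M)
    fix c
    show "P (vscale M c x) = vscale M c (P x)"
      unfolding xJ vscale_M J_scale[OF fh, symmetric] P[OF fh] P[OF F_scale(1)[OF fh(1)] F_scale(1)[OF fh(2)]]
      using J_scale[OF F_diff(1)[OF fh(1) B_carr[OF fh(2)]] F_zero(1), of c] by (simp add: B_scale scaleC_diff_right)
    \<comment> \<open>The constant comes from the bound \<parallel>f\<parallel> + K
      \<parallel>h\<parallel> for the norm of f - B h.\<close>
    show "vnorm M (P x) \<le> (1 + K) * vnorm M x"
    proof (rule le_norm_M[OF x])
      fix f h assume fh: "f \<in> carr F" "h \<in> carr F" "J f h = x"
      have "vnorm M (P x) \<le> vnorm F (\<lambda>u. 0) + vnorm F (\<lambda>u. f u - B h u)"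
        unfolding fh(3)[symmetric] P[OF fh(1,2)] by (rule norm_M_le[OF F_diff(1)[OF fh(1) B_carr[OF fh(2)]] F_zero(1)])
      also have "\<dots> \<le> vnorm F f + K * vnorm F h"
        using F_diff(2)[OF fh(1) B_carr[OF fh(2)]] K(2)[OF fh(2)] F_zero(2) by simp
      also have "\<dots> \<le> (1 + K) * (vnorm F h + vnorm F f)"
        using F_norm_nonneg[OF fh(1)] F_norm_nonneg[OF fh(2)] K(1) by (simp add: algebra_simps)
      finally show "vnorm M (P x) \<le> (1 + K) * (vnorm F h + vnorm F f)" .
    qed (use K in simp)
  next
    fix x y assume "x \<in> carr M" "y \<in> carr M"
    then obtain f h f' h' where fh: "f \<in> carr F" "h \<in> carr F" "x = J f h"
      and fh': "f' \<in> carr F" "h' \<in> carr F" "y = J f' h'" unfolding carr_M by blast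
    show "P (vadd M x y) = vadd M (P x) (P y)"
      unfolding fh(3) fh'(3) vadd_M J_add[OF fh(1,2) fh'(1,2), symmetric] P[OF fh(1,2)] P[OF fh'(1,2)]
        P[OF F_add(1)[OF fh(1) fh'(1)] F_add(1)[OF fh(2) fh'(2)]]
      using J_add[OF F_diff(1)[OF fh(1) B_carr[OF fh(2)]] F_zero(1) F_diff(1)[OF fh'(1) B_carr[OF fh'(2)]] F_zero(1)]
      by (simp add: B_add algebra_simps)
  qed
  \<comment> \<open>As B 0 = 0, P fixes the range; together with \<open>Pin\<close> this makes P
    idempotent.\<close>
  moreover have P0: "P (J g (\<lambda>u. 0)) = J g (\<lambda>u. 0)" if "g \<in> carr F" for g
    using P[OF that F_zero(1)] by (simp add: B_zero)
  moreover have Pin: "P x \<in> {J g (\<lambda>u. 0) | g. g \<in> carr F}" if "x \<in> carr M" for x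
    using that P F_diff(1) B_carr unfolding carr_M by blast
  moreover have "P (P x) = P x" if "x \<in> carr M" for x using Pin[OF that] P0 by auto
  moreover have "P ` carr M = {J g (\<lambda>u. 0) | g. g \<in> carr F}"
  proof (intro subset_antisym image_subsetI Pin subsetI)
    fix y assume "y \<in> {J g (\<lambda>u. 0) | g. g \<in> carr F}"
    then obtain g where g: "g \<in> carr F" "y = J g (\<lambda>u. 0)" by blast
    then have "y \<in> carr M" using F_zero(1) unfolding carr_M by blast
    then show "y \<in> P ` carr M" using P0[OF g(1)] g(2) by (metis imageI)
  qed
  ultimately show ?thesis unfolding complemented_in_def by blast
qed

section \<open>The quotient by the range, described by the fibres of J f h \<mapsto> j0 h\<close>

definition fiber :: "(nat \<Rightarrow> 'a) \<Rightarrow> (nat \<Rightarrow> 'a \<times> 'a) set" where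
  "fiber x = {J f h | f h. f \<in> carr F \<and> h \<in> carr F \<and> j0 h = x}"

abbreviation Q :: "(nat \<Rightarrow> 'a \<times> 'a) set cnspace" where
  "Q \<equiv> quotient_space M {J g (\<lambda>u. 0) | g. g \<in> carr F}"

text \<open>Adding \<open>J g 0\<close> changes f but not h, and \<open>J_same_j0\<close> gives the
  converse. The cosets are therefore exactly the fibres, and R parametrizes the quotient.\<close>

lemma coset_J:
  assumes "f \<in> carr F" "h \<in> carr F"
  shows "coset M {J g (\<lambda>u. 0) | g. g \<in> carr F} (J f h) = fiber (j0 h)"
proof (intro subset_antisym subsetI)
  fix y assume "y \<in> coset M {J g (\<lambda>u. 0) | g. g \<in> carr F} (J f h)"
  then obtain g where "g \<in> carr F" "y = (\<lambda>j. J f h j + J g (\<lambda>u. 0) j)"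
    by (auto simp: coset_def vadd_M)
  then have "y = J (\<lambda>u. f u + g u) h" "(\<lambda>u. f u + g u) \<in> carr F"
    using J_add[OF assms _ F_zero(1)] F_add(1)[OF assms(1)] by auto
  then show "y \<in> fiber (j0 h)" using assms(2) by (auto simp: fiber_def)
next
  fix y assume "y \<in> fiber (j0 h)"
  then obtain f' h' where fh': "f' \<in> carr F" "h' \<in> carr F" "j0 h' = j0 h" "y = J f' h'"
    by (auto simp: fiber_def)
  have "(\<lambda>u. f' u - f u - B (\<lambda>u. h' u - h u) u) \<in> carr F"
    using assms fh' F_diff(1) B_carr by auto
  then show "y \<in> coset M {J g (\<lambda>u. 0) | g. g \<in> carr F} (J f h)"
    unfolding fh'(4) J_same_j0[OF assms fh'(1-3)] coset_def vadd_M by blast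
qed

lemma carr_Q: "carr Q = fiber ` carr R"
proof -
  have "carr Q = coset M {J g (\<lambda>u. 0) | g. g \<in> carr F} ` carr M" by (simp add: quotient_space_def)
  also have "\<dots> = fiber ` carr R"
    unfolding carr_M carr_R using coset_J F_zero(1) by (auto simp: image_iff)
  finally show ?thesis .
qed

lemma J_in_fiber: "f \<in> carr F \<Longrightarrow> h \<in> carr F \<Longrightarrow> J f h \<in> fiber (j0 h)"
  unfolding fiber_def by blast

lemma fiber_nonempty: "x \<in> carr R \<Longrightarrow> fiber x \<noteq> {}"
  unfolding carr_R using J_in_fiber[OF F_zero(1)] by blast

lemma fiber_subset_M: "fiber x \<subseteq> carr M" unfolding fiber_def carr_M by blast

lemma J_in_fiberD: "f \<in> carr F \<Longrightarrow> h \<in> carr F \<Longrightarrow> J f h \<in> fiber x \<Longrightarrow> j0 h = x"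
  unfolding fiber_def using J_eq_imp_j0_eq by blast

lemma bij_fiber: "bij_betw fiber (carr R) (carr Q)"
  unfolding bij_betw_def
proof
  show "inj_on fiber (carr R)"
  proof (rule inj_onI)
    fix x y assume "x \<in> carr R" "y \<in> carr R" "fiber x = fiber y"
    then obtain h where "h \<in> carr F" "x = j0 h" unfolding carr_R by blast
    then show "x = y" using J_in_fiber J_in_fiberD F_zero(1) \<open>fiber x = fiber y\<close> by metis
  qed
qed (simp add: carr_Q)

lemma vadd_Q:
  assumes "x \<in> carr R" "y \<in> carr R"
  shows "vadd Q (fiber x) (fiber y) = fiber (vadd R x y)"
proof -
  obtain h k where h: "h \<in> carr F" "x = j0 h" and k: "k \<in> carr F" "y = j0 k"
    using assms unfolding carr_R by blast
  have "{(\<lambda>j. p j + q j) | p q. p \<in> fiber x \<and> q \<in> fiber y} = fiber (\<lambda>j. x j + y j)"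
  proof (intro subset_antisym subsetI)
    fix r assume "r \<in> {(\<lambda>j. p j + q j) | p q. p \<in> fiber x \<and> q \<in> fiber y}"
    then obtain f1 h1 f2 h2 where 1: "f1 \<in> carr F" "h1 \<in> carr F" "j0 h1 = x" and 2: "f2 \<in> carr F" "h2 \<in> carr F" "j0 h2 = y"
      and r: "r = (\<lambda>j. J f1 h1 j + J f2 h2 j)" unfolding fiber_def by blast
    have "r = J (\<lambda>u. f1 u + f2 u) (\<lambda>u. h1 u + h2 u)" using r J_add 1 2 by simp
    then show "r \<in> fiber (\<lambda>j. x j + y j)"
      using J_in_fiber[OF F_add(1)[OF 1(1) 2(1)] F_add(1)[OF 1(2) 2(2)]] 1 2 by (simp add: j0_add)
  next
    fix r assume "r \<in> fiber (\<lambda>j. x j + y j)"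
    then obtain f1 h1 where 1: "f1 \<in> carr F" "h1 \<in> carr F" "j0 h1 = (\<lambda>j. x j + y j)" and r: "r = J f1 h1"
      unfolding fiber_def by blast
    \<comment> \<open>A given h1 is split as h + (h1 - h), and f1 goes entirely to the second
      summand.\<close>
    note d = F_diff(1)[OF 1(2) h(1)]
    have "r = (\<lambda>j. J (\<lambda>u. 0) h j + J f1 (\<lambda>u. h1 u - h u) j)"
      using J_add[OF F_zero(1) h(1) 1(1) d] by (simp add: r)
    moreover have "J (\<lambda>u. 0) h \<in> fiber x" using J_in_fiber[OF F_zero(1) h(1)] h(2) by simp
    moreover have "J f1 (\<lambda>u. h1 u - h u) \<in> fiber y"
      using J_in_fiber[OF 1(1) d] 1 h by (simp add: j0_diff)
    ultimately show "r \<in> {(\<lambda>j. p j + q j) | p q. p \<in> fiber x \<and> q \<in> fiber y}" by blast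
  qed
  then show ?thesis by (simp add: quotient_space_def vadd_M vadd_rochberg)
qed

text \<open>Each scaled element of the fibre, with the range added, fills one coset, and all these
  cosets coincide. For c = 0 this gives the whole range.\<close>

lemma vscale_Q:
  assumes "x \<in> carr R"
  shows "vscale Q c (fiber x) = fiber (vscale R c x)"
proof -
  let ?N = "{J g (\<lambda>u. 0) | g. g \<in> carr F}"
  have c: "coset M ?N (\<lambda>j. c *\<^sub>C p j) = fiber (\<lambda>j. c *\<^sub>C x j)" if "p \<in> fiber x" for p
  proof -
    obtain f h where fh: "f \<in> carr F" "h \<in> carr F" "j0 h = x" "p = J f h"
      using \<open>p \<in> fiber x\<close> unfolding fiber_def by blast
    show ?thesis
      using coset_J[OF F_scale(1)[OF fh(1), of c] F_scale(1)[OF fh(2), of c]] fh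
      by (simp add: J_scale j0_scale)
  qed
  have "fiber x \<noteq> {}" using fiber_nonempty[OF assms] by simp
  have "{vadd M (vscale M c a) w | a w. a \<in> fiber x \<and> w \<in> ?N} = (\<Union>p\<in>fiber x. coset M ?N (\<lambda>j. c *\<^sub>C p j))"
    unfolding coset_def vscale_M by blast
  also have "\<dots> = fiber (\<lambda>j. c *\<^sub>C x j)" using c \<open>fiber x \<noteq> {}\<close> by simp
  finally show ?thesis by (simp add: quotient_space_def vscale_rochberg)
qed

text \<open>The identification is isometric: the representative \<open>J 0 h\<close> has norm at
  most \<parallel>h\<parallel>, while every representative satisfies \<parallel>j0 h\<parallel>
  \<le> \<parallel>h\<parallel> \<le> \<parallel>h\<parallel> + \<parallel>f\<parallel>.\<close>

lemma norm_Q_eq: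
  assumes "x \<in> carr R"
  shows "vnorm Q (fiber x) = vnorm R x"
proof (rule antisym)
  have Q: "vnorm Q (fiber x) = Inf (vnorm M ` fiber x)" by (simp add: quotient_space_def)
  have "bdd_below (vnorm M ` fiber x)"
    using fiber_subset_M norm_M_nonneg by (intro bdd_belowI[of _ 0]) auto
  then have low: "vnorm Q (fiber x) \<le> vnorm M y" if "y \<in> fiber x" for y
    unfolding Q using that by (intro cInf_lower) auto
  have "vnorm Q (fiber x) \<le> 1 * vnorm R x"
  proof (rule le_rochberg_norm[OF assms])
    fix h assume h: "h \<in> carr F" "jet (m - Suc 0) h z = x"
    have "vnorm Q (fiber x) \<le> vnorm M (J (\<lambda>u. 0) h)"
      using low J_in_fiber[OF F_zero(1) h(1)] h(2) by (simp add: j0_def)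
    also have "\<dots> \<le> vnorm F h" using norm_M_le[OF F_zero(1) h(1)] F_zero(2) by simp
    finally show "vnorm Q (fiber x) \<le> 1 * vnorm F h" by simp
  qed simp
  then show "vnorm Q (fiber x) \<le> vnorm R x" by simp
  show "vnorm R x \<le> vnorm Q (fiber x)"
    unfolding Q
  proof (rule cInf_greatest)
    show "vnorm M ` fiber x \<noteq> {}" using fiber_nonempty[OF assms] by simp
    fix t assume "t \<in> vnorm M ` fiber x"
    then obtain y where y: "y \<in> fiber x" "t = vnorm M y" by blast
    have "vnorm R x \<le> 1 * vnorm M y"
    proof (rule le_norm_M)
      show "y \<in> carr M" using y(1) fiber_subset_M by blast
      fix f h assume fh: "f \<in> carr F" "h \<in> carr F" "J f h = y"
      then have "j0 h = x" using J_in_fiberD y(1) by blast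
      then show "vnorm R x \<le> 1 * (vnorm F h + vnorm F f)"
        using norm_R_le[OF fh(2)] F_norm_nonneg[OF fh(1)] by simp
    qed simp
    then show "vnorm R x \<le> t" using y(2) by simp
  qed
qed

lemma isomorphic_Q: "isomorphic_spaces Q R"
proof -
  define T where "T = the_inv_into (carr R) fiber"
  have inj: "inj_on fiber (carr R)" using bij_fiber by (rule bij_betw_imp_inj_on)
  have T: "T (fiber x) = x" if "x \<in> carr R" for x unfolding T_def by (rule the_inv_into_f_f[OF inj that])
  have bij: "bij_betw T (carr Q) (carr R)" unfolding T_def by (rule bij_betw_the_inv_into[OF bij_fiber])
  have Ti: "the_inv_into (carr Q) T x = fiber x" if "x \<in> carr R" for x
    by (rule the_inv_into_f_eq) (use bij that T in \<open>auto simp: bij_betw_def carr_Q\<close>)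
  have fQ: "fiber x \<in> carr Q" if "x \<in> carr R" for x using that unfolding carr_Q by (rule imageI)
  have add: "vadd R x y \<in> carr R" if xy: "x \<in> carr R" "y \<in> carr R" for x y
  proof -
    obtain h k where h: "h \<in> carr F" "x = j0 h" and k: "k \<in> carr F" "y = j0 k" using xy unfolding carr_R by blast
    have "vadd R x y = j0 (\<lambda>u. h u + k u)" unfolding vadd_rochberg h(2) k(2) j0_add[OF h(1) k(1)] ..
    then show ?thesis unfolding carr_R using F_add(1)[OF h(1) k(1)] by simp
  qed
  have scale: "vscale R c x \<in> carr R" if x: "x \<in> carr R" for c x
  proof -
    obtain h where h: "h \<in> carr F" "x = j0 h" using x unfolding carr_R by blast
    have "vscale R c x = j0 (\<lambda>u. c *\<^sub>C h u)" unfolding vscale_rochberg h(2) j0_scale[OF h(1)] ..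
    then show ?thesis unfolding carr_R using F_scale(1)[OF h(1)] by simp
  qed
  have "bounded_operator Q R T"
    unfolding bounded_operator_def carr_Q
    by (intro conjI exI[of _ 1]) (auto simp: T vadd_Q vscale_Q add scale norm_Q_eq)
  moreover have "bounded_operator R Q (the_inv_into (carr Q) T)"
    unfolding bounded_operator_def
    using fQ by (intro conjI exI[of _ 1]) (auto simp: Ti vadd_Q vscale_Q add scale norm_Q_eq)
  ultimately show ?thesis unfolding isomorphic_spaces_def using bij by blast
qed

end

theorem proposition7p3:
  fixes U :: "complex set" and F :: "(complex \<Rightarrow> 'a::complex_banach) cnspace"
    and \<psi> :: "complex \<Rightarrow> complex" and z :: complex and m :: nat
  assumes "acceptable U F"
    and "conformal_equiv \<psi> unit_disc U"
    and "m \<ge> 1" and "z \<in> U"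
  shows "bounded_operator (rochberg F (m + 1) z) (F2_space U \<psi> F m z) (E2_op m) \<and>
    complemented_in (E2_op m ` carr (rochberg F (m + 1) z)) (F2_space U \<psi> F m z) \<and>
    isomorphic_spaces
      (quotient_space (F2_space U \<psi> F m z) (E2_op m ` carr (rochberg F (m + 1) z)))
      (rochberg F (m - 1) z)"
proof -
  interpret acceptable_point U F \<psi> z m
    by unfold_locales (rule assms)+
  have "m - 1 = m - Suc 0" by simp
  then show ?thesis unfolding E2_range using bounded_E2 complemented_E2 isomorphic_Q by metis
qed

end
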